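(* Let $n\ge 1$ be an integer, $0<p<n$, and $1\le q\le\infty$. There is a constant $C>0$, depending only on $n$, $p$ and $q$ (in particular independent of $\delta$ and of the functions below), such that for every $\delta>0$, with $\omega$ the kernel $\omega(\mathbf{x})=\omega_0|\mathbf{x}|^{-p}$ for $0<|\mathbf{x}|<\delta$ and $\omega(\mathbf{x})=0$ otherwise, where $\omega_0>0$ is chosen so that $$\int_{\{|\hat{\mathbf{x}}|<\delta\}} \hat{x}_j\,\omega(\hat{\mathbf{x}})\,\frac{\hat{x}_j}{|\hat{\mathbf{x}}|}\,d\hat{\mathbf{x}}=1\quad\text{for } j=1,\dots,n,$$ the following hold: (i) for every vector field $\mathbf{u}\in W^{3,q}(\mathbb{R}^n;\mathbb{R}^n)$, $\ \|\mathcal{D}_\omega(\mathbf{u})-\nabla\cdot\mathbf{u}\|_{L^q(\mathbb{R}^n)}\le C\delta^2\|\mathbf{u}\|_{W^{3,q}(\mathbb{R}^n)}$; (ii) for every scalar function $u\in W^{3,q}(\mathbb{R}^n)$, $\ \|\mathcal{G}_\omega(u)-\nabla u\|_{L^q(\mathbb{R}^n)}\le C\delta^2\|u\|_{W^{3,q}(\mathbb{R}^n)}$; (iii) if $n=3$, for every vector field $\mathbf{u}\in W^{3,q}(\mathbb{R}^3;\mathbb{R}^3)$, $\ \|\mathcal{C}_\omega(\mathbf{u})-\nabla\times\mathbf{u}\|_{L^q(\mathbb{R}^3)}\le C\delta^2\|\mathbf{u}\|_{W^{3,q}(\mathbb{R}^3)}$.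
   Context: $|\cdot|$ is the Euclidean norm on $\mathbb{R}^n$ and $H_{\mathbf{x}}^\delta=\{\hat{\mathbf{x}}\in\mathbb{R}^n: |\hat{\mathbf{x}}-\mathbf{x}|<\delta\}$. For $\hat{\mathbf{x}}\ne\mathbf{x}$ put $\mathbf{e}=\frac{\hat{\mathbf{x}}-\mathbf{x}}{|\hat{\mathbf{x}}-\mathbf{x}|}$. The nonlocal divergence, gradient and (for $n=3$) curl operators are $$\mathcal{D}_\omega(\mathbf{v})(\mathbf{x})=\int_{H_{\mathbf{x}}^\delta}\omega(\hat{\mathbf{x}}-\mathbf{x})\,(\mathbf{v}(\hat{\mathbf{x}})-\mathbf{v}(\mathbf{x}))\cdot\mathbf{e}\,d\hat{\mathbf{x}},$$ $$\mathcal{G}_\omega(v)(\mathbf{x})=\int_{H_{\mathbf{x}}^\delta}\omega(\hat{\mathbf{x}}-\mathbf{x})\,(v(\hat{\mathbf{x}})-v(\mathbf{x}))\,\mathbf{e}\,d\hat{\mathbf{x}},$$ $$\mathcal{C}_\omega(\mathbf{v})(\mathbf{x})=\int_{H_{\mathbf{x}}^\delta}\omega(\hat{\mathbf{x}}-\mathbf{x})\;\mathbf{e}\times(\mathbf{v}(\hat{\mathbf{x}})-\mathbf{v}(\mathbf{x}))\,d\hat{\mathbf{x}}.$$ The normalization condition is equivalent to $\omega_0=\frac{n-p+1}{\alpha_n\delta^{n-p+1}}$, where $\alpha_n$ is the volume of the unit ball in $\mathbb{R}^n$. $W^{3,q}$ is the usual Sobolev space. *)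

theory Defs
  imports "HOL-Analysis.Analysis" "HOL-Probability.Essential_Supremum"
begin

text \<open>Functions are representatives of their almost-everywhere classes. The Euclidean norm of the
  codomain is used for vector-valued functions. The exponent ranges over the extended reals.\<close>

definition Lq :: "ereal \<Rightarrow> (real^'n \<Rightarrow> 'b::euclidean_space) set" where
  "Lq q = {f \<in> borel_measurable lebesgue.
     if q = \<infinity> then (\<exists>B. AE x in lebesgue. norm (f x) \<le> B)
     else integrable lebesgue (\<lambda>x. norm (f x) powr real_of_ereal q)}"

definition Lq_norm :: "ereal \<Rightarrow> (real^'n \<Rightarrow> 'b::euclidean_space) \<Rightarrow> real" where
  "Lq_norm q f =
     (if q = \<infinity> then real_of_ereal (esssup lebesgue (\<lambda>x. ereal (norm (f x))))
      else (LINT x|lebesgue. norm (f x) powr real_of_ereal q) powr (1 / real_of_ereal q))"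

definition locally_integrable :: "(real^'n \<Rightarrow> 'b::euclidean_space) \<Rightarrow> bool" where
  "locally_integrable f \<longleftrightarrow> (\<forall>K. compact K \<longrightarrow> set_integrable lebesgue K f)"

definition partial :: "'n \<Rightarrow> (real^'n \<Rightarrow> real) \<Rightarrow> real^'n \<Rightarrow> real" where
  "partial i f x = frechet_derivative f (at x) (axis i 1)"

primrec iter_partial :: "'n list \<Rightarrow> (real^'n \<Rightarrow> real) \<Rightarrow> real^'n \<Rightarrow> real" where
  "iter_partial [] f = f"
| "iter_partial (i # is) f = partial i (iter_partial is f)"

text \<open>All iterated partial derivatives exist and are differentiable, hence continuous: this is
  membership in \<open>C\<^sup>\<infinity>\<close>.\<close>

definition test_function :: "(real^'n \<Rightarrow> real) \<Rightarrow> bool" where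
  "test_function \<phi> \<longleftrightarrow>
     (\<forall>is x. iter_partial is \<phi> differentiable (at x)) \<and> compact (closure {x. \<phi> x \<noteq> 0})"

text \<open>A multi-index is a function \<open>\<alpha> :: 'n \<Rightarrow> nat\<close>. The index type carries no order, so the classical
  derivative of a test function with multi-index \<open>\<alpha>\<close> is written as an iterated partial derivative
  along an arbitrary list of coordinates in which each \<open>i\<close> occurs \<open>\<alpha> i\<close> times; by the symmetry of
  higher derivatives the choice of the list is irrelevant.\<close>

definition has_weak_deriv ::
  "('n \<Rightarrow> nat) \<Rightarrow> (real^'n \<Rightarrow> 'b::euclidean_space) \<Rightarrow> (real^'n \<Rightarrow> 'b) \<Rightarrow> bool" where
  "has_weak_deriv \<alpha> u g \<longleftrightarrow> locally_integrable u \<and> locally_integrable g \<and>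
     (\<forall>\<phi> is. test_function \<phi> \<longrightarrow> (\<forall>i. count_list is i = \<alpha> i) \<longrightarrow>
        (LINT x|lebesgue. iter_partial is \<phi> x *\<^sub>R u x) =
        (-1) ^ (\<Sum>i\<in>UNIV. \<alpha> i) *\<^sub>R (LINT x|lebesgue. \<phi> x *\<^sub>R g x))"

text \<open>A choice of representative; weak derivatives are unique almost everywhere.\<close>

definition weak_deriv ::
  "('n \<Rightarrow> nat) \<Rightarrow> (real^'n \<Rightarrow> 'b::euclidean_space) \<Rightarrow> real^'n \<Rightarrow> 'b" where
  "weak_deriv \<alpha> u = (SOME g. has_weak_deriv \<alpha> u g)"

definition multi_indices :: "nat \<Rightarrow> ('n::finite \<Rightarrow> nat) set" where
  "multi_indices k = {\<alpha>. (\<Sum>i\<in>UNIV. \<alpha> i) \<le> k}"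

definition sobolev :: "nat \<Rightarrow> ereal \<Rightarrow> (real^'n \<Rightarrow> 'b::euclidean_space) set" where
  "sobolev k q = {u \<in> Lq q. \<forall>\<alpha>\<in>multi_indices k. \<exists>g\<in>Lq q. has_weak_deriv \<alpha> u g}"

definition sobolev_norm :: "nat \<Rightarrow> ereal \<Rightarrow> (real^'n \<Rightarrow> 'b::euclidean_space) \<Rightarrow> real" where
  "sobolev_norm k q u =
     (if q = \<infinity> then Max ((\<lambda>\<alpha>. Lq_norm q (weak_deriv \<alpha> u)) ` multi_indices k)
      else (\<Sum>\<alpha>\<in>multi_indices k. Lq_norm q (weak_deriv \<alpha> u) powr real_of_ereal q)
             powr (1 / real_of_ereal q))"

definition weak_partial :: "'n \<Rightarrow> (real^'n \<Rightarrow> 'b::euclidean_space) \<Rightarrow> real^'n \<Rightarrow> 'b" where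
  "weak_partial i u = weak_deriv (\<lambda>j. if j = i then 1 else 0) u"

definition local_div :: "(real^'n \<Rightarrow> real^'n) \<Rightarrow> real^'n \<Rightarrow> real" where
  "local_div u x = (\<Sum>i\<in>UNIV. weak_partial i u x $ i)"

definition local_grad :: "(real^'n \<Rightarrow> real) \<Rightarrow> real^'n \<Rightarrow> real^'n" where
  "local_grad u x = (\<chi> i. weak_partial i u x)"

definition local_curl :: "(real^3 \<Rightarrow> real^3) \<Rightarrow> real^3 \<Rightarrow> real^3" where
  "local_curl u x = vector
     [weak_partial 2 u x $ 3 - weak_partial 3 u x $ 2,
      weak_partial 3 u x $ 1 - weak_partial 1 u x $ 3,
      weak_partial 1 u x $ 2 - weak_partial 2 u x $ 1]"

definition kernel :: "real \<Rightarrow> real \<Rightarrow> real \<Rightarrow> real^'n \<Rightarrow> real" where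
  "kernel \<omega>0 p \<delta> x = (if 0 < norm x \<and> norm x < \<delta> then \<omega>0 * norm x powr (- p) else 0)"

definition normalized :: "real \<Rightarrow> (real^'n \<Rightarrow> real) \<Rightarrow> bool" where
  "normalized \<delta> \<omega> \<longleftrightarrow>
     (\<forall>j. (LINT y:{y. norm y < \<delta>}|lebesgue. y $ j * \<omega> y * (y $ j / norm y)) = 1)"

definition horizon :: "real \<Rightarrow> real^'n \<Rightarrow> (real^'n) set" where
  "horizon \<delta> x = {y. norm (y - x) < \<delta>}"

definition unit_dir :: "real^'n \<Rightarrow> real^'n \<Rightarrow> real^'n" where
  "unit_dir x y = (y - x) /\<^sub>R norm (y - x)"

definition div_integrand ::
  "(real^'n \<Rightarrow> real) \<Rightarrow> (real^'n \<Rightarrow> real^'n) \<Rightarrow> real^'n \<Rightarrow> real^'n \<Rightarrow> real" where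
  "div_integrand \<omega> v x y = \<omega> (y - x) * ((v y - v x) \<bullet> unit_dir x y)"

definition grad_integrand ::
  "(real^'n \<Rightarrow> real) \<Rightarrow> (real^'n \<Rightarrow> real) \<Rightarrow> real^'n \<Rightarrow> real^'n \<Rightarrow> real^'n" where
  "grad_integrand \<omega> v x y = (\<omega> (y - x) * (v y - v x)) *\<^sub>R unit_dir x y"

definition curl_integrand ::
  "(real^3 \<Rightarrow> real) \<Rightarrow> (real^3 \<Rightarrow> real^3) \<Rightarrow> real^3 \<Rightarrow> real^3 \<Rightarrow> real^3" where
  "curl_integrand \<omega> v x y = \<omega> (y - x) *\<^sub>R cross3 (unit_dir x y) (v y - v x)"

definition nonlocal_div ::
  "real \<Rightarrow> (real^'n \<Rightarrow> real) \<Rightarrow> (real^'n \<Rightarrow> real^'n) \<Rightarrow> real^'n \<Rightarrow> real" where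
  "nonlocal_div \<delta> \<omega> v x = (LINT y:horizon \<delta> x|lebesgue. div_integrand \<omega> v x y)"

definition nonlocal_grad ::
  "real \<Rightarrow> (real^'n \<Rightarrow> real) \<Rightarrow> (real^'n \<Rightarrow> real) \<Rightarrow> real^'n \<Rightarrow> real^'n" where
  "nonlocal_grad \<delta> \<omega> v x = (LINT y:horizon \<delta> x|lebesgue. grad_integrand \<omega> v x y)"

definition nonlocal_curl ::
  "real \<Rightarrow> (real^3 \<Rightarrow> real) \<Rightarrow> (real^3 \<Rightarrow> real^3) \<Rightarrow> real^3 \<Rightarrow> real^3" where
  "nonlocal_curl \<delta> \<omega> v x = (LINT y:horizon \<delta> x|lebesgue. curl_integrand \<omega> v x y)"

end

theory Submission
  imports Defs
begin

text \<open>The kernel \<open>K z = \<omega> z *\<^sub>R (z / norm z)\<close> is integrable because \<open>p < n\<close>; it is odd, and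
  by the normalization and reflection symmetry the first moment \<open>\<integral> K\<^sub>i z z\<^sub>j dz\<close> is \<open>1\<close> if
  \<open>i = j\<close> and \<open>0\<close> otherwise. Inserting Taylor's formula of order three with integral remainder for a test
  function \<open>\<phi>\<close> into \<open>\<integral> K\<^sub>i z \<phi> (x - z) dz\<close>, only \<open>- \<partial>\<^sub>i \<phi> x\<close> and the remainder survive;
  the remainder is a sum of weighted averages of third derivatives of \<open>\<phi>\<close> over shifts of length at
  most \<open>\<delta>\<close>. By duality (Fubini and the fundamental lemma of the calculus of variations) the same
  identity holds almost everywhere for the weak derivatives of a Sobolev function, so the consistency
  error is a sum of averages of its third weak derivatives. The total mass of each weight is at most
  \<open>\<delta>\<^sup>2 \<integral> \<omega> z norm z dz = n \<delta>\<^sup>2\<close>, and averaging with a weight of mass \<open>W\<close> has norm at most \<open>W\<close>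
  on every \<open>L\<^sup>q\<close>.\<close>

section \<open>Smooth bump functions\<close>

text \<open>Duality is preferred to approximating \<open>u\<close> by smooth functions because
  density fails at \<open>q = \<infinity>\<close>; with the Taylor expansion placed on the test
  function, all exponents are treated alike. The price is a supply of test functions for the
  fundamental lemma: bumps converging to the indicator of an arbitrary open box are enough. Borel
  representatives are used throughout because \<open>f (x + \<tau> s)\<close> is jointly measurable
  in \<open>(s, x)\<close> when \<open>f\<close> is Borel, while this may fail for a merely Lebesgue
  measurable \<open>f\<close>. The normalization controls the size of the error through one
  identity: adding the \<open>n\<close> diagonal first moments gives the integral of
  \<open>\<omega> z * norm z\<close>, which is therefore \<open>n\<close>, with no trace of
  \<open>\<omega>0\<close> or \<open>p\<close>. The final constant is \<open>n^9\<close>: the error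
  is a sum of \<open>n^4\<close> remainder terms, a crude triangle inequality that is uniform in
  \<open>q\<close> costs the square of their number, and each term contributes mass at most
  \<open>n * \<delta>^2\<close>.\<close>

primrec flat_poly :: "nat \<Rightarrow> real poly" where
  "flat_poly 0 = 1"
| "flat_poly (Suc k) = [:0, 0, 1:] * (flat_poly k - pderiv (flat_poly k))"

text \<open>The \<open>k\<close>-th derivative of \<open>t \<mapsto> exp (- 1 / t)\<close>, extended by zero to \<open>t \<le> 0\<close>.\<close>

definition flat_exp :: "nat \<Rightarrow> real \<Rightarrow> real" where
  "flat_exp k t = (if 0 < t then poly (flat_poly k) (1 / t) * exp (- (1 / t)) else 0)"

lemma poly_times_exp_neg_tendsto_0: "((\<lambda>s. poly p s * exp (- s)) \<longlongrightarrow> (0::real)) at_top"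
proof -
  have "((\<lambda>s. \<Sum>i\<le>degree p. coeff p i * (s ^ i / exp s)) \<longlongrightarrow> (\<Sum>i\<le>degree p. coeff p i * 0)) at_top"
    by (intro tendsto_intros tendsto_power_div_exp_0)
  moreover have "(\<lambda>s. \<Sum>i\<le>degree p. coeff p i * (s ^ i / exp s)) = (\<lambda>s. poly p s * exp (- s))"
    by (auto simp: poly_altdef exp_minus sum_distrib_right divide_inverse mult.assoc)
  ultimately show ?thesis by simp
qed

text \<open>For \<open>t > 0\<close>, differentiating \<open>P (1/t) * exp (- 1/t)\<close> gives
  \<open>(1/t)^2 * (P - P') (1/t) * exp (- 1/t)\<close>, which is the recursion of
  \<open>flat_poly\<close>. At \<open>t = 0\<close> the exponential beats every power of
  \<open>1/t\<close>, so both one-sided difference quotients tend to 0.\<close>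

lemma flat_exp_has_derivative:
  "(flat_exp k has_real_derivative flat_exp (Suc k) t) (at t)"
proof -
  consider "0 < t" | "t < 0" | "t = 0" by linarith
  then show ?thesis
  proof cases
    case 1
    have "((\<lambda>t. poly (flat_poly k) (1 / t) * exp (- (1 / t))) has_real_derivative flat_exp (Suc k) t) (at t)"
      using 1 unfolding flat_exp_def
      by (auto intro!: derivative_eq_intros DERIV_chain2[OF poly_DERIV]
          simp: divide_simps power2_eq_square algebra_simps)
    then show ?thesis
      by (rule has_field_derivative_transform_within_open[where S = "{0<..}"])
        (use 1 in \<open>auto simp: flat_exp_def\<close>)
  next
    case 2
    have "((\<lambda>t. 0) has_real_derivative flat_exp (Suc k) t) (at t)"
      using 2 by (auto simp: flat_exp_def)
    then show ?thesis
      by (rule has_field_derivative_transform_within_open[where S = "{..<0}"])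
        (use 2 in \<open>auto simp: flat_exp_def\<close>)
  next
    case 3
    \<comment> \<open>With \<open>s = 1 / h\<close> the difference quotient
      \<open>flat_exp k h / h\<close> becomes \<open>s * P s * exp (- s)\<close>; the factor
      \<open>[:0, 1:]\<close> is this division by \<open>h\<close>.\<close>
    have "((\<lambda>s. poly ([:0, 1:] * flat_poly k) s * exp (- s)) \<longlongrightarrow> 0) at_top"
      by (rule poly_times_exp_neg_tendsto_0)
    then have "((\<lambda>h. poly ([:0, 1:] * flat_poly k) (inverse h) * exp (- inverse h)) \<longlongrightarrow> 0) (at_right 0)"
      by (rule filterlim_compose[OF _ filterlim_inverse_at_top_right])
    then have R: "((\<lambda>h. flat_exp k h / h) \<longlongrightarrow> 0) (at_right 0)"
      by (rule Lim_transform_eventually)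
        (auto simp: eventually_at_filter flat_exp_def divide_inverse)
    have L: "((\<lambda>h. flat_exp k h / h) \<longlongrightarrow> 0) (at_left 0)"
      by (rule Lim_transform_eventually[OF tendsto_const])
        (auto simp: eventually_at_filter flat_exp_def)
    have "((\<lambda>h. flat_exp k h / h) \<longlongrightarrow> 0) (at 0)"
      using filterlim_split_at[OF L R] .
    then show ?thesis
      using 3 by (simp add: DERIV_def flat_exp_def)
  qed
qed

lemma flat_exp_nonneg: "0 \<le> flat_exp 0 t" and flat_exp_le_1: "flat_exp 0 t \<le> 1"
  by (auto simp: flat_exp_def)

lemma flat_exp_tendsto_1:
  assumes "0 < t"
  shows "(\<lambda>m. flat_exp 0 (real (Suc m) * t)) \<longlonglongrightarrow> 1"
proof -
  have "(\<lambda>m. exp (- (inverse (real (Suc m)) * (1 / t)))) \<longlonglongrightarrow> exp (- (0 * (1 / t)))"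
    by (intro tendsto_intros LIMSEQ_inverse_real_of_nat)
  moreover have "flat_exp 0 (real (Suc m) * t) = exp (- (inverse (real (Suc m)) * (1 / t)))" for m
    using assms by (simp add: flat_exp_def inverse_eq_divide)
  ultimately show ?thesis by simp
qed

lemma partial_eq:
  assumes "(f has_derivative f') (at x)"
  shows "partial i f x = f' (axis i 1)"
  using frechet_derivative_at[OF assms] by (simp add: partial_def)

text \<open>An algebra of functions closed under \<open>partial\<close>: it contains
  \<open>flat_exp k\<close> for every \<open>k\<close>, and differentiation only raises
  \<open>k\<close>. Smoothness of the bumps thus becomes an induction on the list of derivatives,
  free of explicit formulas.\<close>

inductive_set flat_functions :: "(real^'n \<Rightarrow> real) set" where
  flat_exp: "(\<lambda>x. flat_exp k (c * x $ i + d)) \<in> flat_functions"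
| const: "(\<lambda>x. c) \<in> flat_functions"
| add: "f \<in> flat_functions \<Longrightarrow> g \<in> flat_functions \<Longrightarrow> (\<lambda>x. f x + g x) \<in> flat_functions"
| mult: "f \<in> flat_functions \<Longrightarrow> g \<in> flat_functions \<Longrightarrow> (\<lambda>x. f x * g x) \<in> flat_functions"

lemma flat_functions_partial:
  fixes f :: "real^'n \<Rightarrow> real"
  assumes "f \<in> flat_functions"
  shows "(\<forall>x. f differentiable (at x)) \<and> partial i f \<in> flat_functions"
  using assms
proof induction
  case (flat_exp k c j d)
  have "((\<lambda>x. flat_exp k (c * x $ j + d)) has_derivative (\<lambda>h. (c * h $ j) * flat_exp (Suc k) (c * x $ j + d))) (at x)" for x :: "real^'n"
    by (rule has_derivative_eq_rhs,
        rule has_derivative_compose[OF _ flat_exp_has_derivative[unfolded has_field_derivative_def]])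
      (auto intro!: derivative_eq_intros bounded_linear_imp_has_derivative[OF bounded_linear_vec_nth])
  note D = this
  have "partial i (\<lambda>x. flat_exp k (c * x $ j + d)) = (\<lambda>x. (if i = j then c else 0) * flat_exp (Suc k) (c * x $ j + d))"
    by (rule ext, subst partial_eq[OF D]) (auto simp: axis_def)
  then show ?case
    using D by (auto simp: differentiable_def intro!: flat_functions.intros)
next
  case (const c)
  have "partial i (\<lambda>x. c) = (\<lambda>x. 0)"
    by (rule ext, subst partial_eq[OF has_derivative_const]) auto
  then show ?case by (auto intro: flat_functions.intros)
next
  case (add f g)
  have D: "((\<lambda>x. f x + g x) has_derivative (\<lambda>h. frechet_derivative f (at x) h + frechet_derivative g (at x) h)) (at x)" for x
    using add by (auto intro!: has_derivative_add simp: frechet_derivative_works[symmetric])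
  have "partial i (\<lambda>x. f x + g x) = (\<lambda>x. partial i f x + partial i g x)"
    by (rule ext, subst partial_eq[OF D]) (simp add: partial_def)
  then show ?case
    using add D by (auto simp: differentiable_def intro!: flat_functions.intros)
next
  case (mult f g)
  have D: "((\<lambda>x. f x * g x) has_derivative (\<lambda>h. f x * frechet_derivative g (at x) h + frechet_derivative f (at x) h * g x)) (at x)" for x
    using mult by (auto intro!: has_derivative_mult simp: frechet_derivative_works[symmetric])
  have "partial i (\<lambda>x. f x * g x) = (\<lambda>x. f x * partial i g x + partial i f x * g x)"
    by (rule ext, subst partial_eq[OF D]) (simp add: partial_def)
  then show ?case
    using mult D by (auto simp: differentiable_def intro!: flat_functions.intros)
qed

lemma flat_functions_iter_partial:
  "f \<in> flat_functions \<Longrightarrow> iter_partial is f \<in> flat_functions"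
  by (induction "is") (auto simp: flat_functions_partial)

lemma flat_functions_prod:
  "(\<And>i. i \<in> I \<Longrightarrow> f i \<in> flat_functions) \<Longrightarrow> (\<lambda>x. \<Prod>i\<in>I. f i x) \<in> flat_functions"
  by (induction I rule: infinite_finite_induct) (auto intro: flat_functions.intros)

text \<open>Each factor is \<open>exp (- 1 / ((m + 1) * d))\<close>, where \<open>d\<close> is the
  signed distance to a face, and 0 if \<open>d \<le> 0\<close>. Scaling \<open>d\<close> keeps the
  zero set fixed and drives the value inside the box to 1, so the bumps converge to the indicator of
  the box and stay below it.\<close>

definition box_bump :: "real^'n \<Rightarrow> real^'n \<Rightarrow> nat \<Rightarrow> real^'n \<Rightarrow> real" where
  "box_bump a b m x =
     (\<Prod>i\<in>UNIV. flat_exp 0 (real (Suc m) * (x $ i - a $ i)) * flat_exp 0 (real (Suc m) * (b $ i - x $ i)))"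

lemma box_bump_flat: "box_bump a b m \<in> flat_functions"
proof -
  have "(\<lambda>x. flat_exp 0 (real (Suc m) * x $ i + - real (Suc m) * a $ i)
      * flat_exp 0 (- real (Suc m) * x $ i + real (Suc m) * b $ i)) \<in> flat_functions" for i
    by (intro flat_functions.intros)
  from flat_functions_prod[of UNIV, OF this] show ?thesis
    unfolding box_bump_def[abs_def] by (simp add: algebra_simps)
qed

lemma box_bump_nonneg: "0 \<le> box_bump a b m x"
  unfolding box_bump_def by (intro prod_nonneg mult_nonneg_nonneg ballI flat_exp_nonneg)

lemma box_bump_outside: "x \<notin> box a b \<Longrightarrow> box_bump a b m x = 0"
proof -
  assume "x \<notin> box a b"
  then obtain i where "\<not> (a $ i < x $ i \<and> x $ i < b $ i)"
    by (auto simp: mem_box_cart)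
  then have "x $ i - a $ i \<le> 0 \<or> b $ i - x $ i \<le> 0"
    by linarith
  then have "flat_exp 0 (real (Suc m) * (x $ i - a $ i)) * flat_exp 0 (real (Suc m) * (b $ i - x $ i)) = 0"
    using mult_nonneg_nonpos[of "real (Suc m)"] by (fastforce simp: flat_exp_def not_less)
  then show ?thesis
    unfolding box_bump_def by (intro prod_zero) auto
qed

lemma box_bump_le_indicator:
  fixes x :: "real^'n"
  shows "box_bump a b m x \<le> indicator (box a b) x"
proof (cases "x \<in> box a b")
  case True
  have "box_bump a b m x \<le> (\<Prod>i\<in>(UNIV::'n set). 1)"
    unfolding box_bump_def
    by (intro prod_mono conjI mult_nonneg_nonneg mult_le_one flat_exp_nonneg flat_exp_le_1)
  with True show ?thesis by simp
qed (simp add: box_bump_outside)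

lemma box_bump_tendsto:
  fixes x :: "real^'n"
  shows "(\<lambda>m. box_bump a b m x) \<longlonglongrightarrow> indicator (box a b) x"
proof (cases "x \<in> box a b")
  case True
  have "(\<lambda>m. box_bump a b m x) \<longlonglongrightarrow> (\<Prod>i\<in>(UNIV::'n set). 1 * 1)"
    unfolding box_bump_def
    using True by (intro tendsto_prod tendsto_mult flat_exp_tendsto_1) (auto simp: mem_box_cart)
  with True show ?thesis by simp
qed (simp add: box_bump_outside)

lemma test_function_box_bump: "test_function (box_bump a b m)"
proof -
  have "closure {x. box_bump a b m x \<noteq> 0} \<subseteq> cbox a b"
    using box_bump_outside box_subset_cbox by (intro closure_minimal) (auto, blast)
  then have "compact (closure {x. box_bump a b m x \<noteq> 0})"
    using closed_Int_compact[OF closed_closure compact_cbox] by (metis inf.absorb_iff1)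
  moreover have "iter_partial is (box_bump a b m) differentiable (at x)" for "is" x
    using flat_functions_partial[OF flat_functions_iter_partial[OF box_bump_flat]] by blast
  ultimately show ?thesis
    by (simp add: test_function_def)
qed

section \<open>The fundamental lemma of the calculus of variations\<close>

text \<open>Each coordinate agrees almost everywhere with a Borel function; the finitely many
  exceptional null sets are united and the coordinates reassembled.\<close>

lemma borel_representative:
  fixes f :: "'a::euclidean_space \<Rightarrow> 'b::euclidean_space"
  assumes "f \<in> borel_measurable lebesgue"
  obtains g where "g \<in> borel_measurable borel" "AE x in lborel. f x = g x"
proof -
  have "\<exists>h\<in>borel_measurable lborel. AE x in lborel. f x \<bullet> b = h x" for b
    using assms by (intro completion_ex_borel_measurable_real) auto
  then obtain h where h: "\<And>b. h b \<in> borel_measurable lborel" "\<And>b. AE x in lborel. f x \<bullet> b = h b x"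
    by metis
  have "AE x in lborel. \<forall>b\<in>Basis. f x \<bullet> b = h b x"
    using h(2) by (simp add: AE_finite_allI)
  then have "AE x in lborel. f x = (\<Sum>b\<in>Basis. h b x *\<^sub>R b)"
  proof eventually_elim
    case (elim x)
    have "f x = (\<Sum>b\<in>Basis. (f x \<bullet> b) *\<^sub>R b)"
      by (simp add: euclidean_representation)
    also have "\<dots> = (\<Sum>b\<in>Basis. h b x *\<^sub>R b)"
      using elim by (intro sum.cong) auto
    finally show ?case .
  qed
  moreover have "(\<lambda>x. \<Sum>b\<in>Basis. h b x *\<^sub>R b) \<in> borel_measurable borel"
    using h(1) by measurable
  ultimately show ?thesis
    using that by blast
qed

text \<open>The Borel counterpart of \<open>locally_integrable\<close>. Balls about the origin
  suffice, as every compact set lies in one of them.\<close>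

definition borel_loc_integrable :: "('a::euclidean_space \<Rightarrow> 'b::euclidean_space) \<Rightarrow> bool" where
  "borel_loc_integrable f \<longleftrightarrow>
     f \<in> borel_measurable borel \<and> (\<forall>r. integrable lborel (\<lambda>x. indicator (cball 0 r) x *\<^sub>R f x))"

lemma borel_loc_integrable_bounded_support:
  fixes f :: "'a::euclidean_space \<Rightarrow> 'b::euclidean_space"
  assumes f: "borel_loc_integrable f" and [measurable]: "\<phi> \<in> borel_measurable borel"
    and "\<And>x. \<bar>\<phi> x\<bar> \<le> B" and "\<And>x. \<phi> x \<noteq> 0 \<Longrightarrow> norm x \<le> r"
  shows "integrable lborel (\<lambda>x. \<phi> x *\<^sub>R f x)"
proof (rule Bochner_Integration.integrable_bound)
  show "integrable lborel (\<lambda>x. B *\<^sub>R (indicator (cball 0 r) x *\<^sub>R f x))"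
    using f by (intro integrable_scaleR_right) (auto simp: borel_loc_integrable_def)
  have [measurable]: "f \<in> borel_measurable borel"
    using f by (simp add: borel_loc_integrable_def)
  show "(\<lambda>x. \<phi> x *\<^sub>R f x) \<in> borel_measurable lborel"
    by measurable
  have "norm (\<phi> x *\<^sub>R f x) \<le> norm (B *\<^sub>R (indicator (cball 0 r) x *\<^sub>R f x))" for x
    using assms(3)[of x] assms(4)[of x] by (cases "\<phi> x = 0") (auto intro!: mult_right_mono)
  then show "AE x in lborel. norm (\<phi> x *\<^sub>R f x) \<le> norm (B *\<^sub>R (indicator (cball 0 r) x *\<^sub>R f x))"
    by simp
qed

lemma borel_loc_integrable_diff:
  assumes "borel_loc_integrable f" "borel_loc_integrable g"
  shows "borel_loc_integrable (\<lambda>x. f x - g x)"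
  using assms by (auto simp: borel_loc_integrable_def algebra_simps intro!: Bochner_Integration.integrable_diff)

lemma borel_loc_integrable_add:
  assumes "borel_loc_integrable f" "borel_loc_integrable g"
  shows "borel_loc_integrable (\<lambda>x. f x + g x)"
  using assms by (auto simp: borel_loc_integrable_def algebra_simps intro!: Bochner_Integration.integrable_add)

lemma borel_loc_integrable_zero: "borel_loc_integrable (\<lambda>x. 0)"
  by (auto simp: borel_loc_integrable_def)

lemma borel_loc_integrable_sum:
  assumes "\<And>i. i \<in> I \<Longrightarrow> borel_loc_integrable (f i)"
  shows "borel_loc_integrable (\<lambda>x. \<Sum>i\<in>I. f i x)"
  using assms
  by (induction I rule: infinite_finite_induct)
    (auto intro: borel_loc_integrable_add borel_loc_integrable_zero)

text \<open>Boxes are an intersection-stable generator of the Borel sets, so Dynkin's argument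
  extends the vanishing of the integrals to every Borel subset of a large box. Taking
  \<open>{x. f x > 0}\<close> and \<open>{x. f x < 0}\<close> then forces \<open>f = 0\<close>
  almost everywhere there.\<close>

lemma AE_zero_if_box_integrals_zero:
  fixes f :: "'a::euclidean_space \<Rightarrow> real"
  assumes [measurable]: "f \<in> borel_measurable borel"
    and int: "\<And>a b. integrable lborel (\<lambda>x. indicator (box a b) x * f x)"
    and zero: "\<And>a b. (LINT x|lborel. indicator (box a b) x * f x) = 0"
  shows "AE x in lborel. f x = 0"
proof -
  have "AE x in lborel. x \<in> box (- real N *\<^sub>R One) (real N *\<^sub>R One) \<longrightarrow> f x = 0" for N
  proof -
    let ?B = "box (- real N *\<^sub>R One) (real N *\<^sub>R One) :: 'a set"
    \<comment> \<open>Cutting down to the bounded box \<open>?B\<close> makes \<open>f\<close>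
      integrable over every Borel set, which the complement and the countable union below rely
      on.\<close>
    have intA: "integrable lborel (\<lambda>x. indicator (A \<inter> ?B) x * f x)" if [measurable]: "A \<in> sets borel" for A
      by (rule Bochner_Integration.integrable_bound[OF int[of "- real N *\<^sub>R One" "real N *\<^sub>R One"]])
        (auto simp: indicator_def)
    have *: "(LINT x|lborel. indicator (A \<inter> ?B) x * f x) = 0" if "A \<in> sets borel" for A
    proof -
      let ?G = "range (\<lambda>(a, b). box a b :: 'a set)"
      have "Int_stable ?G"
        unfolding Int_stable_def by (auto simp: box_Int_box)
      moreover have "?G \<subseteq> Pow UNIV"
        by simp
      moreover have "A \<in> sigma_sets UNIV ?G"
        using that by (simp add: borel_eq_box sets_measure_of)
      ultimately show ?thesis
      proof (induction rule: sigma_sets_induct_disjoint)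
        case (basic A)
        then show ?case by (auto simp: box_Int_box zero)
      next
        case (compl A)
        then have [measurable]: "A \<in> sets borel"
          by (simp add: borel_eq_box sets_measure_of)
        have "(LINT x|lborel. indicator ((UNIV - A) \<inter> ?B) x * f x)
            = (LINT x|lborel. indicator (UNIV \<inter> ?B) x * f x - indicator (A \<inter> ?B) x * f x)"
          by (rule Bochner_Integration.integral_cong) (auto simp: indicator_def)
        also have "\<dots> = 0"
          using compl by (subst Bochner_Integration.integral_diff[OF intA intA]) (auto simp: zero)
        finally show ?case .
      next
        case (union A)
        then have [measurable]: "A i \<in> sets borel" for i
          using union(2) by (auto simp: borel_eq_box sets_measure_of)
        have "(LINT x|lborel. indicator ((\<Union>i. A i) \<inter> ?B) x * f x)
            = (LINT x:(\<Union>i. A i \<inter> ?B)|lborel. f x)"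
          by (simp add: set_lebesgue_integral_def Int_UN_distrib2)
        also have "\<dots> = (\<Sum>i. LINT x:A i \<inter> ?B|lborel. f x)"
        proof (rule lebesgue_integral_countable_add)
          show "set_integrable lborel (\<Union>i. A i \<inter> ?B) f"
            using intA[of "\<Union>i. A i"] by (simp add: set_integrable_def Int_UN_distrib2)
        qed (use union(1) in \<open>auto simp: disjoint_family_on_def\<close>)
        also have "\<dots> = 0"
          using union by (simp add: set_lebesgue_integral_def)
        finally show ?case .
      qed auto
    qed
    have "AE x in lborel. indicator ({x. f x > 0} \<inter> ?B) x * f x = 0"
      using *[of "{x. f x > 0}"] intA[of "{x. f x > 0}"]
      by (subst integral_nonneg_eq_0_iff_AE[symmetric]) (auto simp: indicator_def simp del: integral_eq_zero_AE)
    moreover have "AE x in lborel. - (indicator ({x. f x < 0} \<inter> ?B) x * f x) = 0"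
      using *[of "{x. f x < 0}"] intA[of "{x. f x < 0}"]
      by (subst integral_nonneg_eq_0_iff_AE[symmetric]) (auto simp: indicator_def mult_le_0_iff)
    ultimately show ?thesis
      by eventually_elim (auto simp: indicator_def split: if_splits)
  qed
  then have "AE x in lborel. \<forall>N. x \<in> box (- real N *\<^sub>R One) (real N *\<^sub>R One) \<longrightarrow> f x = 0"
    by (intro AE_all_countable[THEN iffD2] allI)
  then show ?thesis
  proof eventually_elim
    case (elim x)
    obtain N where "norm x < real N"
      using reals_Archimedean2 by blast
    have "x \<in> box (- real N *\<^sub>R One) (real N *\<^sub>R One)"
      unfolding mem_box
    proof
      fix i :: 'a assume "i \<in> Basis"
      with Basis_le_norm[of i x] \<open>norm x < real N\<close>
      show "(- real N *\<^sub>R One) \<bullet> i < x \<bullet> i \<and> x \<bullet> i < (real N *\<^sub>R One) \<bullet> i"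
        by (simp add: abs_le_iff)
    qed
    with elim show ?case by blast
  qed
qed

lemma test_function_measurable:
  assumes "test_function \<phi>"
  shows "iter_partial is \<phi> \<in> borel_measurable borel"
  using assms unfolding test_function_def
  by (intro borel_measurable_continuous_onI) (simp add: continuous_at_imp_continuous_on differentiable_imp_continuous_within)

text \<open>The hypothesis is applied to the bumps alone. They are dominated by the indicator of
  their box and converge to it, so each component of \<open>f\<close> has integral 0 over every
  box.\<close>

lemma AE_zero_if_test_integrals_zero:
  fixes f :: "real^'n \<Rightarrow> 'b::euclidean_space"
  assumes f: "borel_loc_integrable f"
    and zero: "\<And>\<phi>. test_function \<phi> \<Longrightarrow> (LINT x|lborel. \<phi> x *\<^sub>R f x) = 0"
  shows "AE x in lborel. f x = 0"
proof -
  have [measurable]: "f \<in> borel_measurable borel"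
    using f by (simp add: borel_loc_integrable_def)
  have "AE x in lborel. f x \<bullet> e = 0" for e :: 'b
  proof (rule AE_zero_if_box_integrals_zero)
    fix a b :: "real^'n"
    obtain r where r: "\<And>x. x \<in> box a b \<Longrightarrow> norm x \<le> r"
      using bounded_box[of a b] unfolding bounded_iff by blast
    have bnd: "integrable lborel (\<lambda>x. \<phi> x *\<^sub>R f x)"
      if "\<phi> \<in> borel_measurable borel" "\<And>x. 0 \<le> \<phi> x" "\<And>x. \<phi> x \<le> indicator (box a b) x" for \<phi>
    proof (rule borel_loc_integrable_bounded_support[OF f that(1)])
      fix x
      show "\<bar>\<phi> x\<bar> \<le> 1"
        using that(2,3)[of x] by (cases "x \<in> box a b") auto
      show "\<phi> x \<noteq> 0 \<Longrightarrow> norm x \<le> r"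
        using that(2,3)[of x] r[of x] by (cases "x \<in> box a b") auto
    qed
    have "integrable lborel (\<lambda>x. indicator (box a b) x *\<^sub>R f x)"
      by (rule bnd) auto
    then have "integrable lborel (\<lambda>x. (indicator (box a b) x *\<^sub>R f x) \<bullet> e)"
      by (intro integrable_inner_left)
    then show int: "integrable lborel (\<lambda>x. indicator (box a b) x * (f x \<bullet> e))"
      by simp
    have m[measurable]: "box_bump a b m \<in> borel_measurable borel" for m
      using test_function_measurable[OF test_function_box_bump, of "[]"] by simp
    have "(\<lambda>m. LINT x|lborel. box_bump a b m x * (f x \<bullet> e)) \<longlonglongrightarrow> (LINT x|lborel. indicator (box a b) x * (f x \<bullet> e))"
    proof (rule integral_dominated_convergence)
      show "integrable lborel (\<lambda>x. \<bar>indicator (box a b) x * (f x \<bullet> e)\<bar>)"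
        using int by simp
      show "AE x in lborel. (\<lambda>m. box_bump a b m x * (f x \<bullet> e)) \<longlonglongrightarrow> indicator (box a b) x * (f x \<bullet> e)"
        by (intro AE_I2 tendsto_mult box_bump_tendsto tendsto_const)
      show "AE x in lborel. norm (box_bump a b m x * (f x \<bullet> e)) \<le> \<bar>indicator (box a b) x * (f x \<bullet> e)\<bar>" for m
        using box_bump_nonneg[of a b m] box_bump_le_indicator[of a b m]
        by (intro AE_I2) (auto simp: abs_mult intro!: mult_right_mono)
    qed measurable
    moreover have "(LINT x|lborel. box_bump a b m x * (f x \<bullet> e)) = 0" for m
    proof -
      have "(LINT x|lborel. (box_bump a b m x *\<^sub>R f x) \<bullet> e) = (LINT x|lborel. box_bump a b m x *\<^sub>R f x) \<bullet> e"
        by (intro integral_inner_left bnd box_bump_nonneg box_bump_le_indicator m)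
      then show ?thesis
        using zero[OF test_function_box_bump, of a b m] by simp
    qed
    ultimately show "(LINT x|lborel. indicator (box a b) x * (f x \<bullet> e)) = 0"
      by (simp add: LIMSEQ_const_iff)
  qed measurable
  then have "AE x in lborel. \<forall>e\<in>Basis. f x \<bullet> e = 0"
    by (simp add: AE_finite_allI)
  then show ?thesis
    by eventually_elim (simp add: euclidean_all_zero_iff)
qed

text \<open>Local integrability gives measurability only of truncations to compact sets;
  \<open>u\<close> is the pointwise limit of its truncations to growing balls.\<close>

lemma locally_integrable_representative:
  fixes u :: "real^'n \<Rightarrow> 'b::euclidean_space"
  assumes "locally_integrable u"
  obtains u' where "borel_loc_integrable u'" "AE x in lborel. u x = u' x"
proof -
  have loc: "integrable lebesgue (\<lambda>x. indicator (cball 0 r) x *\<^sub>R u x)" for r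
    using assms by (simp add: locally_integrable_def set_integrable_def)
  have "u \<in> borel_measurable lebesgue"
  proof (rule borel_measurable_LIMSEQ_metric)
    show "(\<lambda>x. indicator (cball 0 (real m)) x *\<^sub>R u x) \<in> borel_measurable lebesgue" for m
      using loc[of "real m"] by (rule borel_measurable_integrable)
    fix x :: "real^'n"
    have "eventually (\<lambda>m. norm x \<le> real m) sequentially"
      using filterlim_real_sequentially by (simp add: filterlim_at_top)
    then have "eventually (\<lambda>m. indicator (cball 0 (real m)) x *\<^sub>R u x = u x) sequentially"
      by eventually_elim auto
    then show "(\<lambda>m. indicator (cball 0 (real m)) x *\<^sub>R u x) \<longlonglongrightarrow> u x"
      by (rule tendsto_eventually)
  qed
  then obtain u' where u': "u' \<in> borel_measurable borel" "AE x in lborel. u x = u' x"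
    using borel_representative by blast
  have "integrable lborel (\<lambda>x. indicator (cball 0 r) x *\<^sub>R u' x)" for r
  proof -
    have "integrable lebesgue (\<lambda>x. indicator (cball 0 r) x *\<^sub>R u' x)"
    proof (rule integrable_cong_AE_imp[OF loc[of r]])
      have "(\<lambda>x. indicator (cball 0 r) x *\<^sub>R u' x) \<in> borel_measurable lborel"
        by (intro borel_measurable_scaleR borel_measurable_indicator) (use u' in \<open>simp_all add: borel_closed\<close>)
      then show "(\<lambda>x. indicator (cball 0 r) x *\<^sub>R u' x) \<in> borel_measurable lebesgue"
        by (rule measurable_completion)
      show "AE x in lebesgue. indicator (cball 0 r) x *\<^sub>R u x = indicator (cball 0 r) x *\<^sub>R u' x"
        using AE_completion[OF u'(2)] by eventually_elim simp
    qed
    then show ?thesis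
      using u'(1) by (subst (asm) integrable_completion)
        (auto intro!: borel_measurable_scaleR borel_measurable_indicator simp: borel_closed)
  qed
  with u' that show ?thesis
    by (auto simp: borel_loc_integrable_def)
qed

section \<open>Weighted averages of shifts\<close>

lemma translation_distr: "distr lborel borel (\<lambda>x. x + c) = (lborel :: 'a::euclidean_space measure)"
proof -
  have "(\<lambda>x. x + c) = (+) c"
    by (auto simp: add.commute)
  then show ?thesis
    by (simp add: lborel_distr_plus)
qed

lemma nn_integral_translation:
  fixes f :: "'a::euclidean_space \<Rightarrow> ennreal"
  assumes [measurable]: "f \<in> borel_measurable borel"
  shows "(\<integral>\<^sup>+x. f (x + c) \<partial>lborel) = (\<integral>\<^sup>+x. f x \<partial>lborel)"
  by (subst translation_distr[of c, symmetric], subst nn_integral_distr) simp_all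

lemma integrable_translation_iff:
  fixes f :: "'a::euclidean_space \<Rightarrow> 'b::euclidean_space"
  assumes [measurable]: "f \<in> borel_measurable borel"
  shows "integrable lborel (\<lambda>x. f (x + c)) \<longleftrightarrow> integrable lborel f"
  by (subst (2) translation_distr[of c, symmetric], subst integrable_distr_eq) simp_all

lemma integral_translation:
  fixes f :: "'a::euclidean_space \<Rightarrow> 'b::euclidean_space"
  assumes [measurable]: "f \<in> borel_measurable borel"
  shows "(LINT x|lborel. f (x + c)) = (LINT x|lborel. f x)"
  by (subst (2) translation_distr[of c, symmetric], subst integral_distr) simp_all

lemma cball_borel [measurable]: "cball x r \<in> sets borel"
  by (simp add: borel_closed)

text \<open>The parameter space is left abstract so that one theory serves twice: for the kernel,
  with \<open>s = z\<close> and shift \<open>z\<close>, and for the Taylor remainder, with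
  \<open>s = (z, t)\<close> and shift \<open>t *\<^sub>R z\<close>. The bound \<open>d\<close> on
  the shifts keeps supports bounded.\<close>

locale shift_average = sigma_finite_measure M for M :: "'s measure" +
  fixes h :: "'s \<Rightarrow> real" and \<tau> :: "'s \<Rightarrow> 'a::euclidean_space" and d :: real
  assumes h_integrable: "integrable M h"
    and shift_measurable [measurable]: "\<tau> \<in> borel_measurable M"
    and shift_bounded: "\<And>s. h s \<noteq> 0 \<Longrightarrow> norm (\<tau> s) \<le> d"
begin

lemma weight_measurable [measurable]: "h \<in> borel_measurable M"
  using h_integrable by auto

sublocale P: pair_sigma_finite M lborel ..

sublocale P': pair_sigma_finite lborel M ..

definition average :: "('a \<Rightarrow> 'b::euclidean_space) \<Rightarrow> 'a \<Rightarrow> 'b" where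
  "average f x = (LINT s|M. h s *\<^sub>R f (x + \<tau> s))"

lemma average_measurable [measurable]:
  fixes f :: "'a \<Rightarrow> 'b::euclidean_space"
  assumes [measurable]: "f \<in> borel_measurable borel"
  shows "average f \<in> borel_measurable borel"
  unfolding average_def[abs_def] by measurable

text \<open>Where the integrand is nonzero, \<open>x + \<tau> s\<close> lies in the ball of radius
  \<open>r + d\<close>. By translation invariance the slice at \<open>s\<close> therefore has norm
  integral at most \<open>\<bar>h s\<bar>\<close> times a constant independent of \<open>s\<close>,
  and \<open>h\<close> is integrable.\<close>

lemma pair_integrable_shift:
  fixes f :: "'a \<Rightarrow> 'b::euclidean_space"
  assumes f: "borel_loc_integrable f" and [measurable]: "\<psi> \<in> borel_measurable borel"
    and B: "\<And>x. \<bar>\<psi> x\<bar> \<le> B" and r: "\<And>x. \<psi> x \<noteq> 0 \<Longrightarrow> norm x \<le> r"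
  shows "integrable (M \<Otimes>\<^sub>M lborel) (\<lambda>(s, x). (h s * \<psi> x) *\<^sub>R f (x + \<tau> s))"
proof -
  have f'[measurable]: "f \<in> borel_measurable borel" and
    F: "integrable lborel (\<lambda>x. indicator (cball 0 (r + d)) x *\<^sub>R f x)"
    using f by (auto simp: borel_loc_integrable_def)
  define K where "K = (LINT x|lborel. norm (indicator (cball 0 (r + d)) x *\<^sub>R f x))"
  have B0: "0 \<le> B"
    using B[of 0] by linarith
  have S: "integrable lborel (\<lambda>x. (h s * \<psi> x) *\<^sub>R f (x + \<tau> s))" (is ?I)
    and N: "(LINT x|lborel. norm ((h s * \<psi> x) *\<^sub>R f (x + \<tau> s))) \<le> \<bar>h s\<bar> * (B * K)" (is ?N) for s
  proof -
    have T: "integrable lborel (\<lambda>x. indicator (cball 0 (r + d)) (x + \<tau> s) *\<^sub>R f (x + \<tau> s))"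
      using F by (subst integrable_translation_iff[where c = "\<tau> s" and f = "\<lambda>x. indicator (cball 0 (r + d)) x *\<^sub>R f x"]) auto
    have T': "(LINT x|lborel. norm (indicator (cball 0 (r + d)) (x + \<tau> s) *\<^sub>R f (x + \<tau> s))) = K"
      unfolding K_def
      by (subst integral_translation[where c = "\<tau> s" and f = "\<lambda>x. norm (indicator (cball 0 (r + d)) x *\<^sub>R f x)"]) auto
    have le: "norm ((h s * \<psi> x) *\<^sub>R f (x + \<tau> s))
        \<le> \<bar>h s\<bar> * (B * norm (indicator (cball 0 (r + d)) (x + \<tau> s) *\<^sub>R f (x + \<tau> s)))" for x
    proof (cases "h s = 0 \<or> \<psi> x = 0")
      case False
      then have "norm (x + \<tau> s) \<le> r + d"
        using shift_bounded[of s] r[of x] norm_triangle_ineq[of x "\<tau> s"] by linarith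
      then show ?thesis
        using B[of x] by (auto simp: abs_mult mult.assoc intro!: mult_left_mono mult_right_mono)
    qed (use B0 in auto)
    show ?I
    proof (rule Bochner_Integration.integrable_bound)
      show "integrable lborel (\<lambda>x. \<bar>h s\<bar> * (B * norm (indicator (cball 0 (r + d)) (x + \<tau> s) *\<^sub>R f (x + \<tau> s))))"
        using T by (intro integrable_mult_right integrable_norm)
      show "AE x in lborel. norm ((h s * \<psi> x) *\<^sub>R f (x + \<tau> s))
          \<le> norm (\<bar>h s\<bar> * (B * norm (indicator (cball 0 (r + d)) (x + \<tau> s) *\<^sub>R f (x + \<tau> s))))"
        by (intro AE_I2 order_trans[OF le]) (simp only: real_norm_def abs_ge_self)
    qed measurable
    then have "(LINT x|lborel. norm ((h s * \<psi> x) *\<^sub>R f (x + \<tau> s)))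
      \<le> (LINT x|lborel. \<bar>h s\<bar> * (B * norm (indicator (cball 0 (r + d)) (x + \<tau> s) *\<^sub>R f (x + \<tau> s))))"
      using T le by (intro integral_mono integrable_norm integrable_mult_right) auto
    also have "\<dots> = \<bar>h s\<bar> * (B * K)"
      using T' by simp
    finally show ?N .
  qed
  show ?thesis
  proof (rule P.Fubini_integrable)
    show "integrable M (\<lambda>s. LINT x|lborel. norm (case (s, x) of (s, x) \<Rightarrow> (h s * \<psi> x) *\<^sub>R f (x + \<tau> s)))"
    proof (rule Bochner_Integration.integrable_bound)
      show "integrable M (\<lambda>s. \<bar>h s\<bar> * (B * K))"
        using h_integrable by simp
      show "AE s in M. norm (LINT x|lborel. norm (case (s, x) of (s, x) \<Rightarrow> (h s * \<psi> x) *\<^sub>R f (x + \<tau> s)))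
          \<le> norm (\<bar>h s\<bar> * (B * K))"
      proof (intro AE_I2)
        fix s
        have "norm (LINT x|lborel. norm (case (s, x) of (s, x) \<Rightarrow> (h s * \<psi> x) *\<^sub>R f (x + \<tau> s)))
            = (LINT x|lborel. norm ((h s * \<psi> x) *\<^sub>R f (x + \<tau> s)))"
          unfolding real_norm_def prod.case by (intro abs_of_nonneg Bochner_Integration.integral_nonneg norm_ge_zero)
        also have "\<dots> \<le> \<bar>h s\<bar> * (B * K)"
          by (rule N)
        also have "\<dots> \<le> norm (\<bar>h s\<bar> * (B * K))"
          by (simp only: real_norm_def abs_ge_self)
        finally show "norm (LINT x|lborel. norm (case (s, x) of (s, x) \<Rightarrow> (h s * \<psi> x) *\<^sub>R f (x + \<tau> s)))
          \<le> norm (\<bar>h s\<bar> * (B * K))" .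
      qed
    qed measurable
    show "AE s in M. integrable lborel (\<lambda>x. case (s, x) of (s, x) \<Rightarrow> (h s * \<psi> x) *\<^sub>R f (x + \<tau> s))"
      using S by simp
  qed measurable
qed

text \<open>In every slice this is the previous integrand translated by \<open>\<tau> s\<close>, so
  the norm integrals agree.\<close>

lemma pair_integrable_adjoint:
  fixes f :: "'a \<Rightarrow> 'b::euclidean_space"
  assumes f: "borel_loc_integrable f" and [measurable]: "\<psi> \<in> borel_measurable borel"
    and B: "\<And>x. \<bar>\<psi> x\<bar> \<le> B" and r: "\<And>x. \<psi> x \<noteq> 0 \<Longrightarrow> norm x \<le> r"
  shows "integrable (M \<Otimes>\<^sub>M lborel) (\<lambda>(s, x). (h s * \<psi> (x - \<tau> s)) *\<^sub>R f x)"
proof -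
  have [measurable]: "f \<in> borel_measurable borel"
    using f by (auto simp: borel_loc_integrable_def)
  have *: "integrable (M \<Otimes>\<^sub>M lborel) (\<lambda>(s, x). (h s * \<psi> x) *\<^sub>R f (x + \<tau> s))"
    by (rule pair_integrable_shift[OF assms])
  show ?thesis
  proof (rule P.Fubini_integrable)
    have "(LINT x|lborel. norm (case (s, x) of (s, x) \<Rightarrow> (h s * \<psi> (x - \<tau> s)) *\<^sub>R f x))
        = (LINT x|lborel. norm (case (s, x) of (s, x) \<Rightarrow> (h s * \<psi> x) *\<^sub>R f (x + \<tau> s)))" for s
      using integral_translation[of "\<lambda>x. norm ((h s * \<psi> (x - \<tau> s)) *\<^sub>R f x)" "\<tau> s"] by simp
    then show "integrable M (\<lambda>s. LINT x|lborel. norm (case (s, x) of (s, x) \<Rightarrow> (h s * \<psi> (x - \<tau> s)) *\<^sub>R f x))"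
      using P.integrable_fst'[OF integrable_norm[OF *]] by simp
    show "AE s in M. integrable lborel (\<lambda>x. case (s, x) of (s, x) \<Rightarrow> (h s * \<psi> (x - \<tau> s)) *\<^sub>R f x)"
      using P.AE_integrable_fst'[OF *]
    proof eventually_elim
      case (elim s)
      then show ?case
        using integrable_translation_iff[of "\<lambda>x. (h s * \<psi> (x - \<tau> s)) *\<^sub>R f x" "\<tau> s"] by simp
    qed
  qed measurable
qed

lemma adjoint_weight_integrable:
  fixes \<psi> :: "'a \<Rightarrow> real"
  assumes [measurable]: "\<psi> \<in> borel_measurable borel" and B: "\<And>x. \<bar>\<psi> x\<bar> \<le> B"
  shows "integrable M (\<lambda>s. h s * \<psi> (x - \<tau> s))"
proof (rule Bochner_Integration.integrable_bound)
  show "integrable M (\<lambda>s. B * h s)"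
    using h_integrable by simp
  have "0 \<le> B"
    using B[of 0] by linarith
  then show "AE s in M. norm (h s * \<psi> (x - \<tau> s)) \<le> norm (B * h s)"
    using B by (intro AE_I2) (simp add: abs_mult mult.commute[of B] mult_left_mono)
qed measurable

lemma average_adjoint_integrable:
  fixes f :: "'a \<Rightarrow> 'b::euclidean_space"
  assumes f: "borel_loc_integrable f" and \<psi>: "\<psi> \<in> borel_measurable borel"
    and B: "\<And>x. \<bar>\<psi> x\<bar> \<le> B" and r: "\<And>x. \<psi> x \<noteq> 0 \<Longrightarrow> norm x \<le> r"
  shows "integrable lborel (\<lambda>x. (LINT s|M. h s * \<psi> (x - \<tau> s)) *\<^sub>R f x)"
proof -
  have "integrable lborel (\<lambda>x. LINT s|M. (h s * \<psi> (x - \<tau> s)) *\<^sub>R f x)"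
    using P'.integrable_fst'[OF P.integrable_product_swap[OF pair_integrable_adjoint[OF assms]]] by simp
  then show ?thesis
    by (simp add: integral_scaleR_left adjoint_weight_integrable[OF \<psi> B])
qed

text \<open>Both forms come from Fubini. The first moves the shift onto the test function, where
  Taylor's formula is available; the second isolates a single shift, so that the definition of a
  weak derivative can be applied for each fixed \<open>s\<close>.\<close>

lemma average_adjoint:
  fixes f :: "'a \<Rightarrow> 'b::euclidean_space"
  assumes f: "borel_loc_integrable f" and [measurable]: "\<psi> \<in> borel_measurable borel"
    and B: "\<And>x. \<bar>\<psi> x\<bar> \<le> B" and r: "\<And>x. \<psi> x \<noteq> 0 \<Longrightarrow> norm x \<le> r"
  shows "(LINT x|lborel. \<psi> x *\<^sub>R average f x) =
    (LINT x|lborel. (LINT s|M. h s * \<psi> (x - \<tau> s)) *\<^sub>R f x)"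
    and "(LINT x|lborel. \<psi> x *\<^sub>R average f x) = (LINT s|M. h s *\<^sub>R (LINT x|lborel. \<psi> x *\<^sub>R f (x + \<tau> s)))"
proof -
  have [measurable]: "f \<in> borel_measurable borel"
    using f by (auto simp: borel_loc_integrable_def)
  have "(LINT x|lborel. \<psi> x *\<^sub>R average f x) = (LINT x|lborel. LINT s|M. (h s * \<psi> x) *\<^sub>R f (x + \<tau> s))"
    unfolding average_def by (simp flip: integral_scaleR_right add: mult.commute)
  also have "\<dots> = (LINT s|M. LINT x|lborel. (h s * \<psi> x) *\<^sub>R f (x + \<tau> s))"
    using pair_integrable_shift[OF assms] by (rule P.Fubini_integral)
  finally have 1: "(LINT x|lborel. \<psi> x *\<^sub>R average f x) = \<dots>" .
  then show "(LINT x|lborel. \<psi> x *\<^sub>R average f x) = (LINT s|M. h s *\<^sub>R (LINT x|lborel. \<psi> x *\<^sub>R f (x + \<tau> s)))"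
    by (simp flip: integral_scaleR_right)
  have 2: "(LINT x|lborel. (h s * \<psi> x) *\<^sub>R f (x + \<tau> s)) = (LINT x|lborel. (h s * \<psi> (x - \<tau> s)) *\<^sub>R f x)" for s
    using integral_translation[of "\<lambda>x. (h s * \<psi> (x - \<tau> s)) *\<^sub>R f x" "\<tau> s"] by simp
  note 1
  also have "(LINT s|M. LINT x|lborel. (h s * \<psi> x) *\<^sub>R f (x + \<tau> s))
      = (LINT s|M. LINT x|lborel. (h s * \<psi> (x - \<tau> s)) *\<^sub>R f x)"
    by (simp add: 2)
  also have "\<dots> = (LINT x|lborel. LINT s|M. (h s * \<psi> (x - \<tau> s)) *\<^sub>R f x)"
    using pair_integrable_adjoint[OF assms] by (rule P.Fubini_integral[symmetric])
  also have "\<dots> = (LINT x|lborel. (LINT s|M. h s * \<psi> (x - \<tau> s)) *\<^sub>R f x)"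
  proof (rule integral_cong_AE)
    show "AE x in lborel. (LINT s|M. (h s * \<psi> (x - \<tau> s)) *\<^sub>R f x) = (LINT s|M. h s * \<psi> (x - \<tau> s)) *\<^sub>R f x"
      using adjoint_weight_integrable[of \<psi> B] B by (intro AE_I2 integral_scaleR_left) auto
  qed measurable
  finally show "(LINT x|lborel. \<psi> x *\<^sub>R average f x) =
    (LINT x|lborel. (LINT s|M. h s * \<psi> (x - \<tau> s)) *\<^sub>R f x)" .
qed

text \<open>For fixed \<open>s\<close> the translate of a null set is null; Fubini exchanges the two
  quantifiers.\<close>

lemma AE_shift:
  assumes "AE x in lborel. Q x"
  shows "AE x in lborel. AE s in M. Q (x + \<tau> s)"
proof -
  obtain N where N: "{x \<in> space lborel. \<not> Q x} \<subseteq> N" "emeasure lborel N = 0" "N \<in> sets lborel"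
    by (rule AE_E[OF assms])
  then have [measurable]: "N \<in> sets borel" by simp
  have "AE x in lborel. x + \<tau> s \<notin> N" for s
  proof -
    have "AE x in distr lborel borel (\<lambda>x. x + \<tau> s). x \<notin> N"
      unfolding translation_distr using N by (intro AE_not_in) (auto simp: null_sets_def)
    then show ?thesis
      by (subst (asm) AE_distr_iff) auto
  qed
  then have "AE s in M. AE x in lborel. x + \<tau> s \<notin> N"
    by simp
  then have "AE x in lborel. AE s in M. x + \<tau> s \<notin> N"
    by (subst P.AE_commute[symmetric]) measurable
  then show ?thesis
    by eventually_elim (use N(1) in \<open>auto elim: eventually_mono\<close>)
qed

text \<open>Almost every slice of an integrable function on the product is integrable. With the
  indicator of a ball as test factor this settles the points of that ball, and countably many balls
  exhaust the space.\<close>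

lemma average_AE_integrable:
  fixes f :: "'a \<Rightarrow> 'b::euclidean_space"
  assumes f: "borel_loc_integrable f"
  shows "AE x in lborel. integrable M (\<lambda>s. h s *\<^sub>R f (x + \<tau> s))"
proof -
  have "AE x in lborel. norm x \<le> real N \<longrightarrow> integrable M (\<lambda>s. h s *\<^sub>R f (x + \<tau> s))" for N
  proof -
    have "integrable (M \<Otimes>\<^sub>M lborel) (\<lambda>(s, x). (h s * indicator (cball 0 (real N)) x) *\<^sub>R f (x + \<tau> s))"
      by (rule pair_integrable_shift[OF f, where B = 1 and r = "real N"]) (auto simp: indicator_def split: if_splits)
    from P'.AE_integrable_fst'[OF P.integrable_product_swap[OF this]]
    show ?thesis
      by eventually_elim (auto simp: indicator_def)
  qed
  then have "AE x in lborel. \<forall>N. norm x \<le> real N \<longrightarrow> integrable M (\<lambda>s. h s *\<^sub>R f (x + \<tau> s))"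
    by (intro AE_all_countable[THEN iffD2] allI)
  then show ?thesis
    by eventually_elim (use real_arch_simple in blast)
qed

lemma average_loc_integrable:
  fixes f :: "'a \<Rightarrow> 'b::euclidean_space"
  assumes f: "borel_loc_integrable f"
  shows "borel_loc_integrable (average f)"
  unfolding borel_loc_integrable_def
proof (intro conjI allI)
  have f'[measurable]: "f \<in> borel_measurable borel"
    using f by (auto simp: borel_loc_integrable_def)
  show "average f \<in> borel_measurable borel"
    by measurable
  fix r
  have "integrable (M \<Otimes>\<^sub>M lborel) (\<lambda>(s, x). (h s * indicator (cball 0 r) x) *\<^sub>R f (x + \<tau> s))"
    by (rule pair_integrable_shift[OF f, where B = 1 and r = r]) (auto simp: indicator_def split: if_splits)
  from P'.integrable_fst'[OF P.integrable_product_swap[OF this]]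
  have "integrable lborel (\<lambda>x. LINT s|M. (indicator (cball 0 r) x * h s) *\<^sub>R f (x + \<tau> s))"
    by (simp add: mult.commute)
  then show "integrable lborel (\<lambda>x. indicator (cball 0 r) x *\<^sub>R average f x)"
    unfolding average_def by (simp flip: scaleR_scaleR)
qed

end

section \<open>Bounds in Lebesgue spaces\<close>

text \<open>Completeness of Lebesgue measure. Through this the consistency error, defined by
  pointwise integrals and chosen weak derivatives, gets its measurability from an explicit Borel
  function.\<close>

lemma lebesgue_measurable_AE_cong:
  fixes f g :: "'a::euclidean_space \<Rightarrow> 'b::euclidean_space"
  assumes "f \<in> borel_measurable lebesgue" and eq: "AE x in lborel. f x = g x"
  shows "g \<in> borel_measurable lebesgue"
proof -
  obtain N where N: "{x \<in> space lborel. f x \<noteq> g x} \<subseteq> N" "emeasure lborel N = 0" "N \<in> sets lborel"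
    by (rule AE_E[OF eq])
  then have "N \<in> null_sets lebesgue"
    by (intro null_sets_completionI) (simp add: null_sets_def)
  then have "{x. f x \<noteq> g x} \<in> null_sets lebesgue"
    by (rule null_sets_completion_subset[rotated]) (use N(1) in simp)
  then have "negligible {x. f x \<noteq> g x}"
    by (simp add: negligible_iff_null_sets)
  moreover have "f measurable_on UNIV"
    using assms(1) by (simp add: measurable_on_iff_borel_measurable lebesgue_on_UNIV_eq)
  ultimately have "g measurable_on UNIV"
    by (intro measurable_on_spike[where S = "{x. f x \<noteq> g x}" and T = UNIV and f = f and g = g]) auto
  then show ?thesis
    by (simp add: measurable_on_iff_borel_measurable lebesgue_on_UNIV_eq)
qed

text \<open>\<open>K\<close> is any upper bound for the norm. With the nonnegative integral the
  inequality contains integrability and is open to Tonelli; \<open>0 \<le> K\<close> allows the root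
  of \<open>K powr q\<close> to be taken back to \<open>K\<close>.\<close>

definition Lq_bounded :: "ereal \<Rightarrow> (real^'n \<Rightarrow> 'b::euclidean_space) \<Rightarrow> real \<Rightarrow> bool" where
  "Lq_bounded q f K \<longleftrightarrow> f \<in> borel_measurable lebesgue \<and> 0 \<le> K \<and>
     (if q = \<infinity> then AE x in lborel. norm (f x) \<le> K
      else (\<integral>\<^sup>+x. ennreal (norm (f x) powr real_of_ereal q) \<partial>lborel) \<le> ennreal (K powr real_of_ereal q))"

lemma Lq_bounded_AE_cong:
  assumes "Lq_bounded q f K" "AE x in lborel. f x = g x"
  shows "Lq_bounded q g K"
proof -
  have "(\<integral>\<^sup>+x. ennreal (norm (g x) powr real_of_ereal q) \<partial>lborel)
      = (\<integral>\<^sup>+x. ennreal (norm (f x) powr real_of_ereal q) \<partial>lborel)"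
    using assms(2) by (intro nn_integral_cong_AE) auto
  moreover have "AE x in lborel. norm (g x) \<le> K" if "AE x in lborel. norm (f x) \<le> K"
    using that assms(2) by eventually_elim simp
  ultimately show ?thesis
    using assms lebesgue_measurable_AE_cong[of f g] by (auto simp: Lq_bounded_def)
qed

lemma Lq_bounded_Lq_norm:
  assumes "1 \<le> q" "f \<in> Lq q"
  shows "Lq_bounded q f (Lq_norm q f)"
proof (cases "q = \<infinity>")
  case True
  obtain B where B: "AE x in lebesgue. norm (f x) \<le> B" and [measurable]: "f \<in> borel_measurable lebesgue"
    using assms True by (auto simp: Lq_def)
  let ?s = "esssup lebesgue (\<lambda>x. ereal (norm (f x)))"
  have "?s \<le> ereal B"
    using B by (intro esssup_I) auto
  \<comment> \<open>As Lebesgue measure is nonzero, the constant 0 has essential supremum 0. This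
    lower bound excludes the value \<open>- \<infinity>\<close>, so \<open>real_of_ereal\<close>
    loses nothing.\<close>
  moreover have "ereal 0 = esssup lebesgue (\<lambda>x::real^'a. ereal 0)"
    by (rule esssup_const[symmetric]) simp
  then have "0 \<le> ?s"
    using esssup_mono[of "\<lambda>x::real^'a. ereal 0" lebesgue "\<lambda>x. ereal (norm (f x))"] by (simp add: zero_ereal_def)
  ultimately obtain s where s: "?s = ereal s" "0 \<le> s"
    by (cases ?s) auto
  have "AE x in lebesgue. norm (f x) \<le> s"
    using esssup_AE[of "\<lambda>x. ereal (norm (f x))" lebesgue] s by simp
  then show ?thesis
    using True s by (simp add: Lq_bounded_def Lq_norm_def AE_completion_iff)
next
  case False
  then obtain r where r: "q = ereal r" "1 \<le> r"
    using assms(1) by (cases q) auto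
  have f: "f \<in> borel_measurable lebesgue" and i: "integrable lebesgue (\<lambda>x. norm (f x) powr r)"
    using assms(2) r by (auto simp: Lq_def)
  have "(\<integral>\<^sup>+x. ennreal (norm (f x) powr r) \<partial>lborel) = (\<integral>\<^sup>+x. ennreal (norm (f x) powr r) \<partial>lebesgue)"
    by (simp add: nn_integral_completion)
  also have "\<dots> = ennreal (LINT x|lebesgue. norm (f x) powr r)"
    using i by (intro nn_integral_eq_integral) auto
  also have "\<dots> = ennreal (Lq_norm q f powr r)"
    using r by (simp add: Lq_norm_def powr_powr integral_nonneg_AE)
  finally show ?thesis
    using f r by (simp add: Lq_bounded_def Lq_norm_def)
qed

lemma Lq_boundedD:
  assumes "1 \<le> q" "Lq_bounded q f K"
  shows "f \<in> Lq q" "Lq_norm q f \<le> K"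
proof -
  have [measurable]: "f \<in> borel_measurable lebesgue" and K: "0 \<le> K"
    using assms(2) by (auto simp: Lq_bounded_def)
  have "f \<in> Lq q \<and> Lq_norm q f \<le> K"
  proof (cases "q = \<infinity>")
    case True
    then have B: "AE x in lebesgue. norm (f x) \<le> K"
      using assms(2) by (auto simp: Lq_bounded_def AE_completion_iff)
    then have "esssup lebesgue (\<lambda>x. ereal (norm (f x))) \<le> ereal K"
      by (intro esssup_I) auto
    then have "real_of_ereal (esssup lebesgue (\<lambda>x. ereal (norm (f x)))) \<le> K"
      using K by (cases "esssup lebesgue (\<lambda>x. ereal (norm (f x)))") auto
    with True B show ?thesis
      by (auto simp: Lq_def Lq_norm_def)
  next
    case False
    then obtain r where r: "q = ereal r" "1 \<le> r"
      using assms(1) by (cases q) auto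
    have le: "(\<integral>\<^sup>+x. ennreal (norm (f x) powr r) \<partial>lebesgue) \<le> ennreal (K powr r)"
      using assms(2) r by (simp add: Lq_bounded_def nn_integral_completion)
    then have i: "integrable lebesgue (\<lambda>x. norm (f x) powr r)"
      by (intro integrableI_bounded) (auto intro: order.strict_trans1)
    have "(LINT x|lebesgue. norm (f x) powr r) \<le> K powr r"
      using le i by (subst (asm) nn_integral_eq_integral) auto
    then have "(LINT x|lebesgue. norm (f x) powr r) powr (1 / r) \<le> (K powr r) powr (1 / r)"
      using r by (intro powr_mono2) (auto intro: integral_nonneg_AE)
    also have "\<dots> = K"
      using K r by (simp add: powr_powr)
    finally show ?thesis
      using r i by (simp add: Lq_def Lq_norm_def)
  qed
  then show "f \<in> Lq q" "Lq_norm q f \<le> K" by auto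
qed

lemma Lq_bounded_mono:
  assumes "1 \<le> q" "Lq_bounded q f K" "K \<le> L"
  shows "Lq_bounded q f L"
proof (cases "q = \<infinity>")
  case True
  with assms show ?thesis
    by (auto simp: Lq_bounded_def elim: eventually_mono)
next
  case False
  then obtain r where r: "q = ereal r" "1 \<le> r"
    using assms(1) by (cases q) auto
  have "ennreal (K powr r) \<le> ennreal (L powr r)"
    using assms r by (intro ennreal_leI powr_mono2) (auto simp: Lq_bounded_def)
  with assms r show ?thesis
    by (auto simp: Lq_bounded_def simp del: ennreal_le_iff intro: order_trans)
qed

text \<open>A triangle inequality obtained from the largest summand: with \<open>c = card I\<close>,
  the power \<open>r\<close> of the sum is at most \<open>c powr r\<close> times the sum of the
  powers. Integration yields \<open>c powr r * c * K powr r\<close>, and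
  \<open>c \<le> c powr r\<close> turns this into \<open>(c^2 * K) powr r\<close>. The factor
  \<open>c^2\<close> is the same for every exponent.\<close>

lemma Lq_bounded_sum:
  fixes F :: "real^'n \<Rightarrow> 'b::euclidean_space" and f :: "'i \<Rightarrow> real^'n \<Rightarrow> 'c::euclidean_space"
  assumes q: "1 \<le> q" and "finite I" and F: "F \<in> borel_measurable lebesgue"
    and le: "AE x in lborel. norm (F x) \<le> (\<Sum>i\<in>I. norm (f i x))"
    and f: "\<And>i. i \<in> I \<Longrightarrow> Lq_bounded q (f i) K" and K: "0 \<le> K"
  shows "Lq_bounded q F (real (card I)^2 * K)"
proof (cases "q = \<infinity>")
  case True
  have "AE x in lborel. \<forall>i\<in>I. norm (f i x) \<le> K"
    using f True \<open>finite I\<close> by (intro AE_finite_allI) (auto simp: Lq_bounded_def)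
  with le have "AE x in lborel. norm (F x) \<le> real (card I)^2 * K"
  proof eventually_elim
    case (elim x)
    have "norm (F x) \<le> (\<Sum>i\<in>I. norm (f i x))"
      by (rule elim)
    also have "\<dots> \<le> real (card I) * K"
      using elim by (intro sum_bounded_above) auto
    also have "\<dots> \<le> real (card I)^2 * K"
      using K by (intro mult_right_mono) (auto simp: power2_eq_square simp flip: of_nat_mult intro: le_square)
    finally show ?case .
  qed
  with True F K show ?thesis
    by (simp add: Lq_bounded_def)
next
  case False
  then obtain r where r: "q = ereal r" "1 \<le> r"
    using assms(1) by (cases q) auto
  let ?c = "real (card I)"
  have m[measurable]: "f i \<in> borel_measurable lebesgue" if "i \<in> I" for i
    using f[OF that] by (simp add: Lq_bounded_def)
  have fi: "(\<integral>\<^sup>+x. ennreal (norm (f i x) powr r) \<partial>lebesgue) \<le> ennreal (K powr r)" if "i \<in> I" for i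
    using f[OF that] r by (simp add: Lq_bounded_def nn_integral_completion)
  have pointwise: "(\<Sum>i\<in>I. norm (f i x)) powr r \<le> ?c powr r * (\<Sum>i\<in>I. norm (f i x) powr r)" for x
  proof (cases "I = {}")
    case False
    define a where "a = Max ((\<lambda>i. norm (f i x)) ` I)"
    obtain j where j: "j \<in> I" "a = norm (f j x)"
      using Max_in[of "(\<lambda>i. norm (f i x)) ` I"] False \<open>finite I\<close> unfolding a_def by blast
    have "(\<Sum>i\<in>I. norm (f i x)) \<le> ?c * a"
      using \<open>finite I\<close> by (intro sum_bounded_above) (auto simp: a_def)
    then have "(\<Sum>i\<in>I. norm (f i x)) powr r \<le> (?c * a) powr r"
      using r by (intro powr_mono2) (auto intro: sum_nonneg)
    also have "\<dots> = ?c powr r * norm (f j x) powr r"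
      using j by (simp add: powr_mult)
    also have "\<dots> \<le> ?c powr r * (\<Sum>i\<in>I. norm (f i x) powr r)"
      using j \<open>finite I\<close> by (intro mult_left_mono member_le_sum) auto
    finally show ?thesis .
  qed auto
  have "(\<integral>\<^sup>+x. ennreal (norm (F x) powr r) \<partial>lebesgue)
      \<le> (\<integral>\<^sup>+x. ennreal (?c powr r) * (\<Sum>i\<in>I. ennreal (norm (f i x) powr r)) \<partial>lebesgue)"
  proof (rule nn_integral_mono_AE)
    show "AE x in lebesgue. ennreal (norm (F x) powr r)
        \<le> ennreal (?c powr r) * (\<Sum>i\<in>I. ennreal (norm (f i x) powr r))"
      using AE_completion[OF le]
    proof eventually_elim
      case (elim x)
      then have "norm (F x) powr r \<le> (\<Sum>i\<in>I. norm (f i x)) powr r"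
        using r by (intro powr_mono2) auto
      also note pointwise
      finally show ?case
        by (simp add: sum_ennreal sum_nonneg ennreal_mult'[symmetric] ennreal_leI)
    qed
  qed
  also have "\<dots> = ennreal (?c powr r) * (\<Sum>i\<in>I. \<integral>\<^sup>+x. ennreal (norm (f i x) powr r) \<partial>lebesgue)"
    using m by (subst nn_integral_cmult) (auto simp: nn_integral_sum simp del: sum_ennreal)
  also have "\<dots> \<le> ennreal (?c powr r) * (\<Sum>i\<in>I. ennreal (K powr r))"
    by (intro mult_left_mono sum_mono fi) auto
  also have "\<dots> = ennreal (?c powr r * (?c * K powr r))"
    by (simp add: ennreal_mult ennreal_of_nat_eq_real_of_nat)
  also have "\<dots> \<le> ennreal ((?c^2 * K) powr r)"
  proof (rule ennreal_leI)
    have "?c \<le> ?c powr r"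
    proof (cases "card I = 0")
      case False
      then have "?c powr 1 \<le> ?c powr r"
        using r by (intro powr_mono) auto
      with False show ?thesis by simp
    qed auto
    then have "?c powr r * (?c * K powr r) \<le> ?c powr r * (?c powr r * K powr r)"
      by (intro mult_left_mono mult_right_mono) auto
    also have "\<dots> = (?c^2 * K) powr r"
      using K by (simp add: powr_mult power2_eq_square)
    finally show "?c powr r * (?c * K powr r) \<le> (?c^2 * K) powr r" .
  qed
  finally show ?thesis
    using r F K by (simp add: Lq_bounded_def nn_integral_completion)
qed

text \<open>The graph of a convex power lies above its tangent at \<open>m\<close>. Writing
  \<open>a = m * x\<close> reduces this to Bernoulli's inequality
  \<open>1 + q * (x - 1) \<le> x powr q\<close>, which is Young's inequality for
  \<open>x powr q\<close> and 1 with weights \<open>1 / q\<close> and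
  \<open>1 - 1 / q\<close>.\<close>

lemma powr_tangent:
  fixes a m q :: real
  assumes "0 < m" "0 \<le> a" "1 \<le> q"
  shows "m powr q + q * m powr (q - 1) * (a - m) \<le> a powr q"
proof (cases "a = 0")
  case True
  have "m powr (q - 1) * m = m powr q"
    using assms by (simp add: powr_diff)
  then have "q * m powr (q - 1) * m = q * m powr q"
    by (simp only: mult.assoc)
  moreover have "1 * m powr q \<le> q * m powr q"
    using assms by (intro mult_right_mono) auto
  ultimately show ?thesis
    unfolding True by (simp only: diff_0 mult_minus_right) simp
next
  case False
  define x where "x = a / m"
  have x: "0 < x" "a = m * x"
    using False assms by (auto simp: x_def)
  have "(x powr q) powr (1 / q) * 1 powr (1 - 1 / q) \<le> 1 / q * x powr q + (1 - 1 / q) * 1"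
    using assms x by (intro Youngs_inequality_0) auto
  then have "x \<le> 1 / q * x powr q + (1 - 1 / q)"
    using assms x by (simp add: powr_powr)
  then have "q * x \<le> q * (1 / q * x powr q + (1 - 1 / q))"
    using assms by (intro mult_left_mono) auto
  then have "1 + q * (x - 1) \<le> x powr q"
    using assms by (simp add: algebra_simps)
  then have "m powr q * (1 + q * (x - 1)) \<le> m powr q * x powr q"
    by (intro mult_left_mono) auto
  also have "m powr q * (1 + q * (x - 1)) = m powr q + q * m powr (q - 1) * (a - m)"
    using assms x by (simp add: powr_diff field_simps)
  also have "m powr q * x powr q = a powr q"
    using assms x by (simp add: powr_mult)
  finally show ?thesis .
qed

text \<open>Integrate the tangent inequality at the weighted mean of \<open>a\<close>.\<close>

lemma weighted_powr_mean:
  fixes w a :: "'s \<Rightarrow> real"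
  assumes w: "integrable M w" "\<And>s. 0 \<le> w s" and [measurable]: "a \<in> borel_measurable M"
    and a: "\<And>s. 0 \<le> a s" and q: "1 \<le> q"
  shows "ennreal ((LINT s|M. w s * a s) powr q)
    \<le> ennreal ((LINT s|M. w s) powr (q - 1)) * (\<integral>\<^sup>+s. ennreal (w s * a s powr q) \<partial>M)"
proof (cases "(LINT s|M. w s * a s) = 0")
  case False
  have [measurable]: "w \<in> borel_measurable M"
    using w(1) by auto
  define W where "W = (LINT s|M. w s)"
  define A where "A = (LINT s|M. w s * a s)"
  \<comment> \<open>A function that is not integrable has Bochner integral 0 by convention, so a
    nonzero integral already gives integrability; in the other case the left-hand side is 0.\<close>
  have i: "integrable M (\<lambda>s. w s * a s)"
    using False not_integrable_integral_eq by blast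
  have A: "0 < A"
    using False w a by (auto simp: A_def less_le intro!: Bochner_Integration.integral_nonneg)
  have W: "0 < W"
  proof (rule ccontr)
    assume "\<not> 0 < W"
    then have "W = 0"
      using w by (simp add: W_def not_less antisym Bochner_Integration.integral_nonneg)
    then have "AE s in M. w s = 0"
      using w by (simp add: W_def integral_nonneg_eq_0_iff_AE)
    then have "A = 0"
      unfolding A_def by (intro integral_eq_zero_AE) auto
    with A show False by simp
  qed
  show ?thesis
  proof (cases "(\<integral>\<^sup>+s. ennreal (w s * a s powr q) \<partial>M) = \<infinity>")
    case True
    then show ?thesis
      using W by (simp add: W_def ennreal_mult_top)
  next
    case False
    then have J: "integrable M (\<lambda>s. w s * a s powr q)"
      using w by (intro integrableI_nonneg) (auto simp: less_top)
    \<comment> \<open>At the weighted mean the linear term of the tangent inequality integrates to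
      \<open>A - m * W = 0\<close>.\<close>
    define m where "m = A / W"
    have m: "0 < m"
      using A W by (simp add: m_def)
    have "(LINT s|M. m powr q * w s + q * m powr (q - 1) * (w s * a s - m * w s)) \<le> (LINT s|M. w s * a s powr q)"
    proof (rule integral_mono)
      show "integrable M (\<lambda>s. m powr q * w s + q * m powr (q - 1) * (w s * a s - m * w s))"
        using i w by auto
      fix s
      have "w s * (m powr q + q * m powr (q - 1) * (a s - m)) \<le> w s * a s powr q"
        using powr_tangent[OF m a q] w(2) by (intro mult_left_mono) auto
      then show "m powr q * w s + q * m powr (q - 1) * (w s * a s - m * w s) \<le> w s * a s powr q"
        by (simp add: algebra_simps)
    qed (rule J)
    also have "(LINT s|M. m powr q * w s + q * m powr (q - 1) * (w s * a s - m * w s))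
        = m powr q * W + q * m powr (q - 1) * (A - m * W)"
      using i w by (simp add: W_def A_def)
    also have "\<dots> = m powr q * W"
      using W by (simp add: m_def)
    finally have "W powr (q - 1) * (m powr q * W) \<le> W powr (q - 1) * (LINT s|M. w s * a s powr q)"
      by (intro mult_left_mono) auto
    moreover have "W powr (q - 1) * (m powr q * W) = A powr q"
      using A W by (simp add: m_def powr_divide powr_diff)
    ultimately have "A powr q \<le> W powr (q - 1) * (LINT s|M. w s * a s powr q)"
      by simp
    then have "ennreal (A powr q) \<le> ennreal (W powr (q - 1)) * ennreal (LINT s|M. w s * a s powr q)"
      by (simp add: ennreal_mult'[symmetric] ennreal_leI)
    also have "ennreal (LINT s|M. w s * a s powr q) = (\<integral>\<^sup>+s. ennreal (w s * a s powr q) \<partial>M)"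
      using J w by (intro nn_integral_eq_integral[symmetric]) auto
    finally show ?thesis
      by (simp add: A_def W_def)
  qed
qed auto

context shift_average
begin

text \<open>Young's convolution inequality with an integrable kernel, in the generality of weighted
  shifts. The weighted power mean inequality is applied at each \<open>x\<close>, Tonelli exchanges
  the integrals, and translation invariance removes the shift; one more factor \<open>W\<close>
  completes \<open>W powr (r - 1)\<close> to \<open>W powr r\<close>.\<close>

lemma average_powr_bound:
  fixes f :: "'a \<Rightarrow> 'b::euclidean_space"
  assumes r: "1 \<le> r" and [measurable]: "f \<in> borel_measurable borel"
  shows "(\<integral>\<^sup>+x. ennreal (norm (average f x) powr r) \<partial>lborel)
    \<le> ennreal ((LINT s|M. \<bar>h s\<bar>) powr r) * (\<integral>\<^sup>+x. ennreal (norm (f x) powr r) \<partial>lborel)"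
proof -
  define W where "W = (LINT s|M. \<bar>h s\<bar>)"
  have W: "0 \<le> W"
    by (simp add: W_def)
  have norm_le: "norm (average f x) \<le> (LINT s|M. \<bar>h s\<bar> * norm (f (x + \<tau> s)))" for x
    unfolding average_def using integral_norm_bound[of M "\<lambda>s. h s *\<^sub>R f (x + \<tau> s)"] by simp
  have "(\<integral>\<^sup>+x. ennreal (norm (average f x) powr r) \<partial>lborel)
    \<le> (\<integral>\<^sup>+x. ennreal (W powr (r - 1)) * (\<integral>\<^sup>+s. ennreal (\<bar>h s\<bar> * norm (f (x + \<tau> s)) powr r) \<partial>M) \<partial>lborel)"
  proof (rule nn_integral_mono)
    fix x
    have "ennreal (norm (average f x) powr r) \<le> ennreal ((LINT s|M. \<bar>h s\<bar> * norm (f (x + \<tau> s))) powr r)"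
      using norm_le r by (intro ennreal_leI powr_mono2) auto
    also have "\<dots> \<le> ennreal (W powr (r - 1)) * (\<integral>\<^sup>+s. ennreal (\<bar>h s\<bar> * norm (f (x + \<tau> s)) powr r) \<partial>M)"
      unfolding W_def using h_integrable r by (intro weighted_powr_mean) auto
    finally show "ennreal (norm (average f x) powr r)
      \<le> ennreal (W powr (r - 1)) * (\<integral>\<^sup>+s. ennreal (\<bar>h s\<bar> * norm (f (x + \<tau> s)) powr r) \<partial>M)" .
  qed
  also have "\<dots> = ennreal (W powr (r - 1)) * (\<integral>\<^sup>+x. \<integral>\<^sup>+s. ennreal (\<bar>h s\<bar> * norm (f (x + \<tau> s)) powr r) \<partial>M \<partial>lborel)"
    by (rule nn_integral_cmult) measurable
  also have "(\<integral>\<^sup>+x. \<integral>\<^sup>+s. ennreal (\<bar>h s\<bar> * norm (f (x + \<tau> s)) powr r) \<partial>M \<partial>lborel)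
      = (\<integral>\<^sup>+s. \<integral>\<^sup>+x. ennreal (\<bar>h s\<bar> * norm (f (x + \<tau> s)) powr r) \<partial>lborel \<partial>M)"
    by (rule P.Fubini') measurable
  also have "\<dots> = (\<integral>\<^sup>+s. ennreal \<bar>h s\<bar> * (\<integral>\<^sup>+x. ennreal (norm (f x) powr r) \<partial>lborel) \<partial>M)"
  proof (rule nn_integral_cong)
    fix s
    have "(\<integral>\<^sup>+x. ennreal (\<bar>h s\<bar> * norm (f (x + \<tau> s)) powr r) \<partial>lborel)
        = ennreal \<bar>h s\<bar> * (\<integral>\<^sup>+x. ennreal (norm (f (x + \<tau> s)) powr r) \<partial>lborel)"
      by (subst nn_integral_cmult[symmetric]) (auto simp: ennreal_mult)
    also have "(\<integral>\<^sup>+x. ennreal (norm (f (x + \<tau> s)) powr r) \<partial>lborel) = (\<integral>\<^sup>+x. ennreal (norm (f x) powr r) \<partial>lborel)"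
      by (rule nn_integral_translation[of "\<lambda>x. ennreal (norm (f x) powr r)"]) measurable
    finally show "(\<integral>\<^sup>+x. ennreal (\<bar>h s\<bar> * norm (f (x + \<tau> s)) powr r) \<partial>lborel)
        = ennreal \<bar>h s\<bar> * (\<integral>\<^sup>+x. ennreal (norm (f x) powr r) \<partial>lborel)" .
  qed
  also have "\<dots> = ennreal W * (\<integral>\<^sup>+x. ennreal (norm (f x) powr r) \<partial>lborel)"
  proof -
    have "(\<integral>\<^sup>+s. ennreal \<bar>h s\<bar> \<partial>M) = ennreal W"
      using h_integrable unfolding W_def by (intro nn_integral_eq_integral) auto
    then show ?thesis
      by (subst nn_integral_multc) auto
  qed
  also have "ennreal (W powr (r - 1)) * \<dots> = ennreal (W powr r) * (\<integral>\<^sup>+x. ennreal (norm (f x) powr r) \<partial>lborel)"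
  proof -
    have "W powr (r - 1) * W = W powr r"
      using W r by (cases "W = 0") (auto simp: powr_diff)
    then show ?thesis
      using W by (simp add: mult.assoc[symmetric] ennreal_mult'[symmetric])
  qed
  finally show ?thesis
    by (simp add: W_def)
qed

lemma average_norm_bound:
  fixes f :: "'a \<Rightarrow> 'b::euclidean_space"
  assumes [measurable]: "f \<in> borel_measurable borel" and "AE x in lborel. norm (f x) \<le> K" "0 \<le> K"
  shows "AE x in lborel. norm (average f x) \<le> (LINT s|M. \<bar>h s\<bar>) * K"
  using AE_shift[OF assms(2)]
proof eventually_elim
  case (elim x)
  have le: "AE s in M. \<bar>h s\<bar> * norm (f (x + \<tau> s)) \<le> \<bar>h s\<bar> * K"
    using elim by eventually_elim (simp add: mult_left_mono)
  have i: "integrable M (\<lambda>s. \<bar>h s\<bar> * K)"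
    using h_integrable by simp
  have "norm (average f x) \<le> (LINT s|M. \<bar>h s\<bar> * norm (f (x + \<tau> s)))"
    unfolding average_def using integral_norm_bound[of M "\<lambda>s. h s *\<^sub>R f (x + \<tau> s)"] by simp
  also have "\<dots> \<le> (LINT s|M. \<bar>h s\<bar> * K)"
  proof (rule integral_mono_AE[OF _ i le])
    show "integrable M (\<lambda>s. \<bar>h s\<bar> * norm (f (x + \<tau> s)))"
    proof (rule Bochner_Integration.integrable_bound[OF i])
      show "AE s in M. norm (\<bar>h s\<bar> * norm (f (x + \<tau> s))) \<le> norm (\<bar>h s\<bar> * K)"
        using le by eventually_elim (use assms(3) in \<open>simp add: abs_mult\<close>)
    qed measurable
  qed
  finally show ?case by simp
qed

end

lemma average_Lq_bounded:
  fixes f :: "real^'n \<Rightarrow> 'b::euclidean_space"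
  assumes sa: "shift_average M h \<tau> d"
    and q: "1 \<le> q" and f: "f \<in> borel_measurable borel" and fK: "Lq_bounded q f K"
  shows "Lq_bounded q (shift_average.average M h \<tau> f) ((LINT s|M. \<bar>h s\<bar>) * K)"
proof -
  interpret shift_average M h \<tau> d by (rule sa)
  have K: "0 \<le> K"
    using fK by (simp add: Lq_bounded_def)
  have meas: "average f \<in> borel_measurable lebesgue"
    using average_measurable[OF f] by (intro measurable_completion) simp
  show ?thesis
  proof (cases "q = \<infinity>")
    case True
    then show ?thesis
      using average_norm_bound[OF f _ K] fK meas K by (simp add: Lq_bounded_def)
  next
    case False
    then obtain r where r: "q = ereal r" "1 \<le> r"
      using q by (cases q) auto
    note average_powr_bound[OF r(2) f]
    also have "ennreal ((LINT s|M. \<bar>h s\<bar>) powr r) * (\<integral>\<^sup>+x. ennreal (norm (f x) powr r) \<partial>lborel)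
        \<le> ennreal ((LINT s|M. \<bar>h s\<bar>) powr r) * ennreal (K powr r)"
      using fK r by (intro mult_left_mono) (auto simp: Lq_bounded_def)
    also have "\<dots> = ennreal (((LINT s|M. \<bar>h s\<bar>) * K) powr r)"
      using K by (simp add: ennreal_mult'[symmetric] powr_mult)
    finally show ?thesis
      using r meas K by (simp add: Lq_bounded_def)
  qed
qed

section \<open>Reflection symmetries of Lebesgue measure and integrability of the kernel\<close>

lemma coordinate_reflection_distr:
  fixes i :: "'n::finite"
  shows "distr lborel borel (\<lambda>z::real^'n. \<chi> k. if k = i then - z $ k else z $ k) = lborel"
proof -
  define c :: "real^'n \<Rightarrow> real" where "c b = (if b = axis i 1 then - 1 else 1)" for b
  define T :: "real^'n \<Rightarrow> real^'n" where "T z = (\<chi> k. if k = i then - z $ k else z $ k)" for z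
  have *: "0 + (\<Sum>b\<in>Basis. (c b * (z \<bullet> b)) *\<^sub>R b) = T z" for z :: "real^'n"
  proof (rule euclidean_eqI)
    fix b :: "real^'n" assume b: "b \<in> Basis"
    then obtain k where k: "b = axis k 1"
      by (auto simp: Basis_vec_def)
    have "(0 + (\<Sum>b\<in>Basis. (c b * (z \<bullet> b)) *\<^sub>R b)) \<bullet> b = c b * (z \<bullet> b)"
      using b by simp
    also have "\<dots> = T z \<bullet> b"
      by (simp add: k T_def c_def inner_axis axis_eq_axis)
    finally show "(0 + (\<Sum>b\<in>Basis. (c b * (z \<bullet> b)) *\<^sub>R b)) \<bullet> b = T z \<bullet> b" .
  qed
  have "lborel = density (distr lborel borel (\<lambda>z. 0 + (\<Sum>b\<in>Basis. (c b * (z \<bullet> b)) *\<^sub>R b))) (\<lambda>_. (\<Prod>b\<in>Basis. \<bar>c b\<bar>))"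
    by (rule lborel_affine_euclidean) (simp add: c_def)
  also have "(\<Prod>b\<in>Basis. \<bar>c b\<bar>) = 1"
    by (intro prod.neutral) (simp add: c_def)
  finally show ?thesis
    unfolding * T_def by (simp add: density_1)
qed

lemma integral_odd_coordinate:
  fixes f :: "real^'n \<Rightarrow> real"
  assumes f: "f \<in> borel_measurable borel"
    and odd: "\<And>z. f (\<chi> k. if k = i then - z $ k else z $ k) = - f z"
  shows "(LINT z|lborel. f z) = 0"
proof -
  have "(\<lambda>z::real^'n. \<chi> k. if k = i then - z $ k else z $ k) \<in> borel_measurable borel"
  proof (intro borel_measurable_continuous_onI continuous_on_vec_lambda)
    show "continuous_on UNIV (\<lambda>z::real^'n. if k = i then - z $ k else z $ k)" for k
      by (cases "k = i") (auto intro!: continuous_intros)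
  qed
  then have "(LINT z|distr lborel borel (\<lambda>z::real^'n. \<chi> k. if k = i then - z $ k else z $ k). f z)
      = (LINT z|lborel. f (\<chi> k. if k = i then - z $ k else z $ k))"
    using f by (intro integral_distr) auto
  then show ?thesis
    by (simp add: odd coordinate_reflection_distr)
qed

lemma integral_odd:
  fixes f :: "'a::euclidean_space \<Rightarrow> real"
  assumes f: "f \<in> borel_measurable borel" and odd: "\<And>z. f (- z) = - f z"
  shows "(LINT z|lborel. f z) = 0"
proof -
  have "lborel = distr lborel borel (\<lambda>z::'a. - z)"
    using lborel_affine[of "- 1" "0::'a"] by (simp add: density_1)
  then have "(LINT z|lborel. f z) = (LINT z|distr lborel borel (\<lambda>z::'a. - z). f z)"
    by simp
  also have "\<dots> = (LINT z|lborel. f (- z))"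
    using f by (intro integral_distr) auto
  finally show ?thesis
    by (simp add: odd)
qed

lemma kernel_measurable [measurable]: "kernel \<omega>0 p \<delta> \<in> borel_measurable borel"
  unfolding kernel_def[abs_def] by measurable

text \<open>Dyadic shells replace polar coordinates. On shell \<open>k\<close> the kernel is at most
  \<open>\<omega>0 * (\<delta> / 2 ^ Suc k) powr (- p)\<close>, and the ball around the shell has
  volume proportional to \<open>(\<delta> / 2 ^ k) ^ n\<close>. The contributions form a geometric
  series whose ratio \<open>2 powr (p - n)\<close> is below 1 because \<open>p < n\<close>.\<close>

lemma kernel_integrable:
  fixes p :: real
  assumes "0 < \<omega>0" "0 < p" "p < real CARD('n::finite)" "0 < \<delta>"
  shows "integrable lborel (kernel \<omega>0 p \<delta> :: real^'n \<Rightarrow> real)"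
proof (rule integrableI_nonneg)
  show "AE x::real^'n in lborel. 0 \<le> kernel \<omega>0 p \<delta> x"
    using assms by (auto simp: kernel_def)
  define V where "V = unit_ball_vol (real CARD('n))"
  define c where "c = \<omega>0 * (\<delta> / 2) powr (- p) * (V * \<delta> ^ CARD('n))"
  define \<rho> where "\<rho> = 2 powr (p - real CARD('n))"
  have V: "0 \<le> V"
    by (simp add: V_def)
  \<comment> \<open>\<open>g k\<close> dominates the kernel on the dyadic shell \<open>\<delta> / 2 ^ Suc k \<le> norm z < \<delta> / 2 ^ k\<close>.\<close>
  define g where "g k z = ennreal (\<omega>0 * (\<delta> / 2 ^ Suc k) powr (- p)) * indicator (ball 0 (\<delta> / 2 ^ k)) z"
    for k and z :: "real^'n"
  have le: "ennreal (kernel \<omega>0 p \<delta> z) \<le> (\<Sum>k. g k z)" for z :: "real^'n"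
  proof (cases "0 < norm z \<and> norm z < \<delta>")
    case True
    obtain m where m: "\<delta> / norm z < 2 ^ m"
      using real_arch_pow[of 2] by auto
    \<comment> \<open>The index of the shell containing \<open>z\<close>: minimality gives the upper
      bound on \<open>norm z\<close>, which for \<open>k = 0\<close> is the support condition
      \<open>norm z < \<delta>\<close>.\<close>
    define k where "k = (LEAST k. \<delta> / 2 ^ Suc k \<le> norm z)"
    have "\<delta> < norm z * 2 ^ m"
      using m True by (simp add: field_simps)
    moreover have "norm z * 2 ^ m \<le> norm z * 2 ^ Suc m"
      by (intro mult_left_mono) auto
    ultimately have "\<delta> \<le> norm z * 2 ^ Suc m"
      by linarith
    then have "\<delta> / 2 ^ Suc m \<le> norm z"
      by (subst pos_divide_le_eq) auto
    then have k1: "\<delta> / 2 ^ Suc k \<le> norm z"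
      unfolding k_def by (rule LeastI)
    have k2: "norm z < \<delta> / 2 ^ k"
    proof (cases k)
      case (Suc l)
      then have "\<not> \<delta> / 2 ^ Suc l \<le> norm z"
        using not_less_Least[of l "\<lambda>k. \<delta> / 2 ^ Suc k \<le> norm z"] by (simp add: k_def)
      with Suc show ?thesis by simp
    qed (use True in simp)
    have "norm z powr (- p) \<le> (\<delta> / 2 ^ Suc k) powr (- p)"
      using assms k1 by (intro powr_mono2') auto
    then have "kernel \<omega>0 p \<delta> z \<le> \<omega>0 * (\<delta> / 2 ^ Suc k) powr (- p)"
      using True assms unfolding kernel_def by (auto intro!: mult_left_mono)
    then have "ennreal (kernel \<omega>0 p \<delta> z) \<le> g k z"
      using k2 by (simp add: g_def ennreal_leI)
    also have "\<dots> = (\<Sum>k\<in>{k}. g k z)" by simp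
    also have "\<dots> \<le> (\<Sum>k. g k z)"
      by (intro sum_le_suminf) auto
    finally show ?thesis .
  qed (auto simp: kernel_def)
  have int_g: "(\<integral>\<^sup>+z. g k z \<partial>lborel) = ennreal (c * \<rho> ^ k)" for k
  proof -
    have "(\<integral>\<^sup>+z. g k z \<partial>lborel)
        = ennreal (\<omega>0 * (\<delta> / 2 ^ Suc k) powr (- p)) * emeasure lborel (ball (0::real^'n) (\<delta> / 2 ^ k))"
      unfolding g_def by (rule nn_integral_cmult_indicator) simp
    also have "emeasure lborel (ball (0::real^'n) (\<delta> / 2 ^ k)) = ennreal (V * (\<delta> / 2 ^ k) ^ CARD('n))"
      using assms by (simp add: emeasure_ball V_def)
    also have "ennreal (\<omega>0 * (\<delta> / 2 ^ Suc k) powr (- p)) * \<dots>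
        = ennreal (\<omega>0 * (\<delta> / 2 ^ Suc k) powr (- p) * (V * (\<delta> / 2 ^ k) ^ CARD('n)))"
      using assms V by (intro ennreal_mult[symmetric]) auto
    also have "\<omega>0 * (\<delta> / 2 ^ Suc k) powr (- p) * (V * (\<delta> / 2 ^ k) ^ CARD('n)) = c * \<rho> ^ k"
    proof -
      have u: "2 powr (- real k) = 1 / 2 ^ k"
        by (simp only: powr_minus_divide powr_realpow[OF zero_less_numeral])
      have "\<delta> / 2 ^ Suc k = \<delta> / 2 * 2 powr (- real k)"
        unfolding u by simp
      then have 1: "(\<delta> / 2 ^ Suc k) powr (- p) = (\<delta> / 2) powr (- p) * 2 powr (real k * p)"
        using assms by (simp only: powr_mult powr_powr) simp
      have "2 powr (- (real k * real CARD('n))) = 1 / (2 ^ k) ^ CARD('n)"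
        by (simp only: powr_minus_divide powr_realpow[OF zero_less_numeral] of_nat_mult[symmetric] power_mult)
      then have 2: "(\<delta> / 2 ^ k) ^ CARD('n) = \<delta> ^ CARD('n) * 2 powr (- (real k * real CARD('n)))"
        by (simp only: power_divide) simp
      have "\<rho> ^ k = \<rho> powr real k"
        by (rule powr_realpow[symmetric]) (simp add: \<rho>_def)
      also have "\<dots> = 2 powr (real k * p + - (real k * real CARD('n)))"
        unfolding \<rho>_def powr_powr by (rule arg_cong[where f = "\<lambda>x. 2 powr x"]) (simp add: algebra_simps)
      finally have 3: "\<rho> ^ k = 2 powr (real k * p) * 2 powr (- (real k * real CARD('n)))"
        by (simp only: powr_add)
      show ?thesis
        unfolding 1 2 3 c_def by (simp only: mult_ac)
    qed
    finally show ?thesis .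
  qed
  have [measurable]: "g k \<in> borel_measurable borel" for k
    unfolding g_def by (intro borel_measurable_times_ennreal borel_measurable_const borel_measurable_indicator) simp
  have c: "0 \<le> c"
    using assms V by (simp add: c_def)
  have \<rho>: "0 < \<rho>" "\<rho> < 1"
    using assms by (auto simp: \<rho>_def powr_less_one)
  have "(\<integral>\<^sup>+z. ennreal (kernel \<omega>0 p \<delta> (z::real^'n)) \<partial>lborel) \<le> (\<integral>\<^sup>+z. (\<Sum>k. g k z) \<partial>lborel)"
    by (intro nn_integral_mono le)
  also have "\<dots> = (\<Sum>k. \<integral>\<^sup>+z. g k z \<partial>lborel)"
    by (intro nn_integral_suminf) measurable
  also have "\<dots> = ennreal (\<Sum>k. c * \<rho> ^ k)"
    unfolding int_g
  proof (rule suminf_ennreal2)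
    show "0 \<le> c * \<rho> ^ k" for k
      using c \<rho> by (intro mult_nonneg_nonneg zero_le_power) auto
    show "summable (\<lambda>k. c * \<rho> ^ k)"
      using \<rho> by (intro summable_mult summable_geometric) simp
  qed
  also have "\<dots> < \<infinity>"
    by simp
  finally show "(\<integral>\<^sup>+z. ennreal (kernel \<omega>0 p \<delta> (z::real^'n)) \<partial>lborel) < \<infinity>" .
qed measurable

section \<open>Moments of the kernel\<close>

lemma borel_measurable_component [measurable (raw)]:
  fixes f :: "'s \<Rightarrow> real^'n"
  assumes "f \<in> borel_measurable M"
  shows "(\<lambda>x. f x $ i) \<in> borel_measurable M"
proof -
  have "(\<lambda>x::real^'n. x $ i) \<in> borel_measurable borel"
    by (intro borel_measurable_continuous_onI continuous_intros)
  from measurable_compose[OF assms this] show ?thesis .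
qed

definition direction_kernel :: "(real^'n \<Rightarrow> real) \<Rightarrow> 'n \<Rightarrow> real^'n \<Rightarrow> real" where
  "direction_kernel \<omega> i z = \<omega> z * (z $ i / norm z)"

locale normalized_kernel =
  fixes \<omega>0 p \<delta> :: real and \<omega> :: "real^'n \<Rightarrow> real"
  assumes \<omega>0: "0 < \<omega>0" and p: "0 < p" "p < real CARD('n)" and \<delta>: "0 < \<delta>"
    and \<omega>: "\<omega> = kernel \<omega>0 p \<delta>" and normalized: "normalized \<delta> \<omega>"
begin

abbreviation "K \<equiv> direction_kernel \<omega>"

lemma \<omega>_measurable [measurable]: "\<omega> \<in> borel_measurable borel"
  by (simp add: \<omega>)

lemma K_measurable [measurable]: "K i \<in> borel_measurable borel"
  unfolding direction_kernel_def[abs_def] by measurable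

lemma \<omega>_nonneg: "0 \<le> \<omega> z"
  using \<omega>0 by (simp add: \<omega> kernel_def)

lemma \<omega>_support: "\<omega> z \<noteq> 0 \<Longrightarrow> norm z < \<delta>"
  by (simp add: \<omega> kernel_def split: if_splits)

lemma \<omega>_integrable: "integrable lborel \<omega>"
  unfolding \<omega> using \<omega>0 p \<delta> by (intro kernel_integrable)

lemma K_le: "\<bar>K i z\<bar> \<le> \<omega> z"
proof -
  have "\<bar>z $ i / norm z\<bar> \<le> 1"
    using component_le_norm_cart[of z i] by (simp add: divide_le_eq_1)
  then have "\<omega> z * \<bar>z $ i / norm z\<bar> \<le> \<omega> z * 1"
    using \<omega>_nonneg by (intro mult_left_mono) auto
  then show ?thesis
    using \<omega>_nonneg[of z] by (simp add: direction_kernel_def abs_mult)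
qed

lemma K_support: "K i z \<noteq> 0 \<Longrightarrow> norm z < \<delta>"
  using \<omega>_support by (auto simp: direction_kernel_def)

lemma K_mult_integrable:
  assumes [measurable]: "f \<in> borel_measurable borel" and B: "\<And>z. norm z < \<delta> \<Longrightarrow> \<bar>f z\<bar> \<le> B"
  shows "integrable lborel (\<lambda>z. K i z * f z)"
proof (rule Bochner_Integration.integrable_bound)
  show "integrable lborel (\<lambda>z. B * \<omega> z)"
    using \<omega>_integrable by simp
  show "AE z in lborel. norm (K i z * f z) \<le> norm (B * \<omega> z)"
  proof (rule AE_I2)
    fix z
    show "norm (K i z * f z) \<le> norm (B * \<omega> z)"
    proof (cases "K i z = 0")
      case False
      then have "\<bar>f z\<bar> \<le> B"
        using B K_support by blast
      then have "\<bar>K i z\<bar> * \<bar>f z\<bar> \<le> \<omega> z * \<bar>B\<bar>"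
        using K_le \<omega>_nonneg by (intro mult_mono) auto
      then show ?thesis
        using \<omega>_nonneg[of z] by (simp add: abs_mult mult.commute)
    qed simp
  qed
qed measurable

lemma component_le_\<delta>: "norm z < \<delta> \<Longrightarrow> \<bar>z $ j\<bar> \<le> \<delta>"
  using component_le_norm_cart[of z j] by linarith

lemma K_integrable: "integrable lborel (K i)"
  using K_mult_integrable[of "\<lambda>z. 1" 1] by simp

lemma K_moment1_integrable: "integrable lborel (\<lambda>z. K i z * z $ j)"
  using component_le_\<delta> by (intro K_mult_integrable) auto

lemma K_moment2_integrable: "integrable lborel (\<lambda>z. K i z * (z $ j * z $ k))"
  using component_le_\<delta> \<delta> by (intro K_mult_integrable[where B = "\<delta> * \<delta>"]) (auto simp: abs_mult intro!: mult_mono)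

lemma \<omega>_even: "norm z = norm z' \<Longrightarrow> \<omega> z = \<omega> z'"
  by (simp add: \<omega> kernel_def)

lemma K_odd: "K i (- z) = - K i z"
  using \<omega>_even[of z "- z"] by (simp add: direction_kernel_def)

lemma K_moment0: "(LINT z|lborel. K i z) = 0"
  by (rule integral_odd) (auto simp: K_odd)

text \<open>An odd kernel against an even monomial. This cancellation removes the second derivatives
  from the expansion and raises the order of consistency from \<open>\<delta>\<close> to
  \<open>\<delta>^2\<close>.\<close>

lemma K_moment2: "(LINT z|lborel. K i z * (z $ j * z $ k)) = 0"
  by (rule integral_odd) (auto simp: K_odd)

lemma K_moment1_same: "(LINT z|lborel. K i z * z $ i) = 1"
proof -
  have "1 = (LINT y:{y. norm y < \<delta>}|lebesgue. y $ i * \<omega> y * (y $ i / norm y))"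
    using normalized by (simp add: normalized_def)
  also have "\<dots> = (LINT y|lebesgue. K i y * y $ i)"
    unfolding set_lebesgue_integral_def direction_kernel_def
    using \<omega>_support by (intro Bochner_Integration.integral_cong) (auto simp: indicator_def)
  also have "\<dots> = (LINT y|lborel. K i y * y $ i)"
    by (rule integral_completion) measurable
  finally show ?thesis by simp
qed

text \<open>Off the diagonal, coordinate \<open>i\<close> alone is reflected: \<open>K i z\<close>
  changes sign while \<open>norm z\<close> and \<open>z $ j\<close> stay the same.\<close>

lemma K_moment1: "(LINT z|lborel. K i z * z $ j) = (if i = j then 1 else 0)"
proof (cases "i = j")
  case False
  have n: "norm (\<chi> k. if k = i then - z $ k else z $ k) = norm z" for z :: "real^'n"
    by (auto simp: norm_vec_def L2_set_def intro!: sum.cong arg_cong[where f = sqrt])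
  have "(LINT z|lborel. K i z * z $ j) = 0"
  proof (rule integral_odd_coordinate[where i = i])
    fix z :: "real^'n"
    show "K i (\<chi> k. if k = i then - z $ k else z $ k) * (\<chi> k. if k = i then - z $ k else z $ k) $ j
      = - (K i z * z $ j)"
      using False \<omega>_even[OF n[of z]] by (simp add: direction_kernel_def n)
  qed measurable
  with False show ?thesis by simp
qed (simp add: K_moment1_same)

text \<open>The diagonal first-moment integrands add up to
  \<open>\<omega> z * (z \<bullet> z) / norm z\<close>, so the \<open>n\<close> normalization
  conditions determine this moment.\<close>

lemma \<omega>_moment_integrable: "integrable lborel (\<lambda>z. \<omega> z * norm z)"
  and \<omega>_moment: "(LINT z|lborel. \<omega> z * norm z) = real CARD('n)"
proof -
  have eq: "\<omega> z * norm z = (\<Sum>i\<in>UNIV. K i z * z $ i)" for z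
  proof (cases "z = 0")
    case False
    have "(\<Sum>i\<in>UNIV. K i z * z $ i) = \<omega> z / norm z * (\<Sum>i\<in>UNIV. z $ i * z $ i)"
      by (simp add: direction_kernel_def sum_distrib_left mult.assoc)
    also have "(\<Sum>i\<in>UNIV. z $ i * z $ i) = z \<bullet> z"
      by (simp add: inner_vec_def)
    also have "z \<bullet> z = norm z * norm z"
      by (simp flip: power2_norm_eq_inner power2_eq_square)
    finally show ?thesis
      using False by simp
  qed simp
  show "integrable lborel (\<lambda>z. \<omega> z * norm z)"
    unfolding eq by (intro Bochner_Integration.integrable_sum K_moment1_integrable)
  show "(LINT z|lborel. \<omega> z * norm z) = real CARD('n)"
    unfolding eq by (subst Bochner_Integration.integral_sum) (auto intro: K_moment1_integrable simp: K_moment1)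
qed

text \<open>The weight of the third-order remainder in Taylor's formula with integral remainder,
  as a function of the displacement \<open>z\<close> and the position \<open>t\<close> on the segment.\<close>

definition remainder_weight :: "'n \<Rightarrow> 'n \<Rightarrow> 'n \<Rightarrow> 'n \<Rightarrow> (real^'n) \<times> real \<Rightarrow> real" where
  "remainder_weight i j k l s =
     (K i (fst s) * (fst s $ j * fst s $ k * fst s $ l)) * ((1 - snd s)^2 / 2 * indicator {0..1} (snd s))"

lemma remainder_weight_measurable [measurable]: "remainder_weight i j k l \<in> borel_measurable borel"
  unfolding remainder_weight_def[abs_def] borel_prod[symmetric] by measurable

text \<open>Two of the three coordinates of \<open>z\<close> are bounded by \<open>\<delta>\<close>
  and the third by \<open>norm z\<close>. The factor \<open>\<omega> z * norm z\<close> is retained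
  because its integral is known exactly.\<close>

lemma remainder_weight_le:
  "\<bar>remainder_weight i j k l (z, t)\<bar> \<le> \<delta>^2 / 2 * (\<omega> z * norm z) * indicator {0..1} t"
proof (cases "K i z = 0 \<or> t \<notin> {0..1}")
  case True
  then show ?thesis
    using \<omega>_nonneg[of z] \<delta> by (auto simp: remainder_weight_def)
next
  case False
  then have z: "norm z < \<delta>" and t: "0 \<le> t" "t \<le> 1"
    using K_support by auto
  have "\<bar>z $ j * z $ k * z $ l\<bar> \<le> \<delta> * \<delta> * norm z"
    unfolding abs_mult using component_le_\<delta>[OF z] component_le_norm_cart \<delta> by (intro mult_mono) auto
  moreover have "\<bar>(1 - t)^2 / 2\<bar> \<le> 1 / 2"
    using t by (simp add: abs_square_le_1)
  ultimately have "(\<bar>K i z\<bar> * \<bar>z $ j * z $ k * z $ l\<bar>) * \<bar>(1 - t)^2 / 2\<bar> \<le> (\<omega> z * (\<delta> * \<delta> * norm z)) * (1 / 2)"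
    using K_le \<omega>_nonneg \<delta> by (intro mult_mono) auto
  then show ?thesis
    using t by (simp add: remainder_weight_def abs_mult power2_eq_square mult_ac)
qed

text \<open>The dominating function is a product in \<open>z\<close> and \<open>t\<close> and has
  integral \<open>\<delta>^2 / 2 * n\<close>. The factor \<open>1 / 2\<close> is then given
  away.\<close>

lemma remainder_weight_integrable: "integrable lborel (remainder_weight i j k l)" (is ?I)
  and remainder_weight_norm: "(LINT s|lborel. \<bar>remainder_weight i j k l s\<bar>) \<le> \<delta>^2 * real CARD('n)" (is ?N)
proof -
  let ?g = "\<lambda>(z::real^'n, t::real). \<delta>^2 / 2 * (\<omega> z * norm z) * indicator {0..1} t"
  have slice: "(LINT t|lborel. \<delta>^2 / 2 * (\<omega> z * norm z) * indicator {0..1::real} t) = \<delta>^2 / 2 * (\<omega> z * norm z)" for z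
    by simp
  have g: "integrable (lborel \<Otimes>\<^sub>M lborel) ?g"
  proof (rule lborel_pair.Fubini_integrable)
    show "integrable lborel (\<lambda>z. LINT t|lborel. norm (case (z, t) of (z, t) \<Rightarrow> \<delta>^2 / 2 * (\<omega> z * norm z) * indicator {0..1::real} t))"
      using \<omega>_moment_integrable \<omega>_nonneg by (simp add: abs_mult)
    show "AE z in lborel. integrable lborel (\<lambda>t. case (z, t) of (z, t) \<Rightarrow> \<delta>^2 / 2 * (\<omega> z * norm z) * indicator {0..1::real} t)"
      unfolding prod.case by (intro AE_I2 integrable_mult_right integrable_real_indicator) auto
  qed measurable
  have ig: "(LINT s|(lborel \<Otimes>\<^sub>M lborel). ?g s) = \<delta>^2 / 2 * real CARD('n)"
    using lborel_pair.integral_fst'[OF g] by (simp add: \<omega>_moment)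
  have le: "\<bar>remainder_weight i j k l s\<bar> \<le> ?g s" for s
    using remainder_weight_le by (cases s) simp
  show I: ?I
    by (rule Bochner_Integration.integrable_bound[OF g[unfolded lborel_prod]])
      (use le in \<open>auto intro!: AE_I2 intro: order_trans[OF _ abs_ge_self]\<close>)
  have "(LINT s|lborel. \<bar>remainder_weight i j k l s\<bar>) \<le> (LINT s|lborel. ?g s)"
    using I g le by (intro integral_mono) (auto simp: lborel_prod)
  also have "\<dots> = \<delta>^2 / 2 * real CARD('n)"
    using ig unfolding lborel_prod .
  also have "\<dots> \<le> \<delta>^2 * real CARD('n)"
    by (intro mult_right_mono) auto
  finally show ?N .
qed

end

section \<open>Taylor's formula for test functions\<close>

lemma test_function_differentiable:
  "test_function \<phi> \<Longrightarrow> iter_partial is \<phi> differentiable (at x)"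
  by (simp add: test_function_def)

lemma test_function_continuous:
  "test_function \<phi> \<Longrightarrow> continuous_on A (iter_partial is \<phi>)"
  by (simp add: test_function_differentiable continuous_at_imp_continuous_on differentiable_imp_continuous_within)

text \<open>The complement of the support is open, so each further derivative vanishes there
  too.\<close>

lemma iter_partial_zero_outside_support:
  "x \<notin> closure {x. \<phi> x \<noteq> 0} \<Longrightarrow> iter_partial is \<phi> x = 0"
proof (induction "is" arbitrary: x)
  case Nil
  then show ?case
    using closure_subset[of "{x. \<phi> x \<noteq> 0}"] by auto
next
  case (Cons i "is")
  have "((\<lambda>x. 0) has_derivative (\<lambda>h. 0)) (at x)"
    by simp
  then have "(iter_partial is \<phi> has_derivative (\<lambda>h. 0)) (at x)"
    by (rule has_derivative_transform_within_open[where s = "- closure {x. \<phi> x \<noteq> 0}"])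
      (use Cons in \<open>auto simp: open_Compl\<close>)
  from partial_eq[OF this] show ?case by simp
qed

lemma test_function_bounds:
  assumes "test_function \<phi>"
  obtains B r where "\<And>x. \<bar>iter_partial is \<phi> x\<bar> \<le> B" "\<And>x. iter_partial is \<phi> x \<noteq> 0 \<Longrightarrow> norm x \<le> r"
proof -
  let ?S = "closure {x. \<phi> x \<noteq> 0}"
  have S: "compact ?S"
    using assms by (simp add: test_function_def)
  then have "bounded (iter_partial is \<phi> ` ?S)"
    by (intro compact_imp_bounded compact_continuous_image test_function_continuous assms)
  then obtain B where B: "\<And>x. x \<in> ?S \<Longrightarrow> \<bar>iter_partial is \<phi> x\<bar> \<le> B"
    by (auto simp: bounded_iff)
  obtain r where r: "\<And>x. x \<in> ?S \<Longrightarrow> norm x \<le> r"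
    using compact_imp_bounded[OF S] unfolding bounded_iff by blast
  show ?thesis
  proof
    show "\<bar>iter_partial is \<phi> x\<bar> \<le> max B 0" for x
      using B[of x] iter_partial_zero_outside_support[of x \<phi> "is"] by (cases "x \<in> ?S") auto
    show "iter_partial is \<phi> x \<noteq> 0 \<Longrightarrow> norm x \<le> r" for x
      using r[of x] iter_partial_zero_outside_support[of x \<phi> "is"] by blast
  qed
qed

lemma has_derivative_along_line:
  fixes f :: "real^'n \<Rightarrow> real"
  assumes "f differentiable (at (x - t *\<^sub>R z))"
  shows "((\<lambda>t. f (x - t *\<^sub>R z)) has_real_derivative - (\<Sum>j\<in>UNIV. z $ j * partial j f (x - t *\<^sub>R z))) (at t)"
proof -
  let ?D = "frechet_derivative f (at (x - t *\<^sub>R z))"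
  have D: "(f has_derivative ?D) (at (x - t *\<^sub>R z))"
    using assms by (simp add: frechet_derivative_works)
  interpret D: bounded_linear ?D
    by (rule has_derivative_bounded_linear[OF D])
  have "?D z = ?D (\<Sum>j\<in>UNIV. z $ j *\<^sub>R axis j 1)"
    using basis_expansion[of z] by (simp add: scalar_mult_eq_scaleR)
  then have z: "?D z = (\<Sum>j\<in>UNIV. z $ j * partial j f (x - t *\<^sub>R z))"
    by (simp add: D.sum D.scaleR partial_def)
  have "((\<lambda>t. x - t *\<^sub>R z) has_derivative (\<lambda>h. - (h *\<^sub>R z))) (at t)"
    by (auto intro!: derivative_eq_intros)
  from has_derivative_compose[OF this D]
  have "((\<lambda>t. f (x - t *\<^sub>R z)) has_derivative (\<lambda>h. ?D (- (h *\<^sub>R z)))) (at t)" .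
  then show ?thesis
    unfolding has_field_derivative_def
    by (rule has_derivative_eq_rhs) (simp add: D.neg D.scaleR z fun_eq_iff)
qed

text \<open>Derivatives are kept as lists in the order in which they arise, with the last one taken
  at the head. This matches \<open>has_weak_deriv\<close>, which accepts every list with the
  prescribed counts.\<close>

lemma taylor_along_line:
  fixes \<phi> :: "real^'n \<Rightarrow> real"
  assumes \<phi>: "test_function \<phi>"
  shows "\<phi> (x - z) = \<phi> x - (\<Sum>j\<in>UNIV. z $ j * iter_partial [j] \<phi> x)
    + (\<Sum>j\<in>UNIV. \<Sum>k\<in>UNIV. z $ j * z $ k * iter_partial [k, j] \<phi> x) / 2
    - (LINT t|lborel. (1 - t)^2 / 2 * indicator {0..1} t *
        (\<Sum>j\<in>UNIV. \<Sum>k\<in>UNIV. \<Sum>l\<in>UNIV. z $ j * z $ k * z $ l * iter_partial [l, k, j] \<phi> (x - t *\<^sub>R z)))"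
proof -
  define \<eta>1 where "\<eta>1 t = (\<Sum>j\<in>UNIV. z $ j * iter_partial [j] \<phi> (x - t *\<^sub>R z))" for t
  define \<eta>2 where "\<eta>2 t = (\<Sum>j\<in>UNIV. \<Sum>k\<in>UNIV. z $ j * z $ k * iter_partial [k, j] \<phi> (x - t *\<^sub>R z))" for t
  define \<eta>3 where "\<eta>3 t = (\<Sum>j\<in>UNIV. \<Sum>k\<in>UNIV. \<Sum>l\<in>UNIV. z $ j * z $ k * z $ l * iter_partial [l, k, j] \<phi> (x - t *\<^sub>R z))" for t
  have D: "((\<lambda>t. iter_partial is \<phi> (x - t *\<^sub>R z)) has_real_derivative
      - (\<Sum>j\<in>UNIV. z $ j * iter_partial (j # is) \<phi> (x - t *\<^sub>R z))) (at t)" for "is" t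
    using has_derivative_along_line[OF test_function_differentiable[OF \<phi>]] by simp
  have D0: "((\<lambda>t. \<phi> (x - t *\<^sub>R z)) has_real_derivative - \<eta>1 t) (at t)" for t
    using D[of "[]"] by (simp add: \<eta>1_def)
  have D1: "(\<eta>1 has_real_derivative - \<eta>2 t) (at t)" for t
  proof -
    have "((\<lambda>t. \<Sum>j\<in>UNIV. z $ j * iter_partial [j] \<phi> (x - t *\<^sub>R z)) has_real_derivative
      (\<Sum>j\<in>UNIV. z $ j * - (\<Sum>k\<in>UNIV. z $ k * iter_partial [k, j] \<phi> (x - t *\<^sub>R z)))) (at t)"
      by (intro DERIV_sum DERIV_cmult D)
    then show ?thesis
      unfolding \<eta>1_def[abs_def] \<eta>2_def by (simp only: sum_distrib_left mult_minus_right sum_negf mult.assoc)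
  qed
  have D2: "(\<eta>2 has_real_derivative - \<eta>3 t) (at t)" for t
  proof -
    have "((\<lambda>t. \<Sum>j\<in>UNIV. \<Sum>k\<in>UNIV. z $ j * z $ k * iter_partial [k, j] \<phi> (x - t *\<^sub>R z)) has_real_derivative
      (\<Sum>j\<in>UNIV. \<Sum>k\<in>UNIV. z $ j * z $ k * - (\<Sum>l\<in>UNIV. z $ l * iter_partial [l, k, j] \<phi> (x - t *\<^sub>R z)))) (at t)"
      by (intro DERIV_sum DERIV_cmult D)
    then show ?thesis
      unfolding \<eta>2_def[abs_def] \<eta>3_def by (simp only: sum_distrib_left mult_minus_right sum_negf mult.assoc)
  qed
  \<comment> \<open>The second-order Taylor polynomial of \<open>\<phi> (x - t *\<^sub>R z)\<close>
    with base point \<open>t\<close>, evaluated at 1. Its derivative in \<open>t\<close> telescopes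
    to the third-order term; \<open>F 1\<close> is \<open>\<phi> (x - z)\<close> and
    \<open>F 0\<close> is the polynomial at the base point 0.\<close>
  define F where "F t = \<phi> (x - t *\<^sub>R z) - (1 - t) * \<eta>1 t + (1 - t)^2 / 2 * \<eta>2 t" for t
  have cont: "isCont \<eta>3 t" for t
  proof -
    have "continuous_on UNIV \<eta>3"
      unfolding \<eta>3_def[abs_def]
      by (intro continuous_intros continuous_on_compose2[OF test_function_continuous[OF \<phi>, of UNIV]]) auto
    then show ?thesis
      by (simp add: continuous_on_eq_continuous_at)
  qed
  have "(LINT t|lborel. - ((1 - t)^2 / 2 * \<eta>3 t) * indicator {0..1} t) = F 1 - F 0"
  proof (rule integral_FTC_Icc_real)
    fix t :: real
    show "(F has_real_derivative - ((1 - t)^2 / 2 * \<eta>3 t)) (at t)"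
      unfolding F_def[abs_def]
      by (rule derivative_eq_intros D0 D1 D2 refl | simp)+ (simp add: field_simps power2_eq_square)
    show "isCont (\<lambda>t. - ((1 - t)^2 / 2 * \<eta>3 t)) t"
      by (intro continuous_intros cont) simp
  qed simp
  moreover have "(LINT t|lborel. - ((1 - t)^2 / 2 * \<eta>3 t) * indicator {0..1} t)
      = - (LINT t|lborel. (1 - t)^2 / 2 * indicator {0..1} t * \<eta>3 t)"
    by (subst Bochner_Integration.integral_minus[symmetric]) (simp add: mult_ac)
  ultimately show ?thesis
    by (simp add: F_def \<eta>1_def \<eta>2_def \<eta>3_def)
qed

context normalized_kernel
begin

lemma K_test_function:
  fixes \<phi> :: "real^'n \<Rightarrow> real"
  assumes \<phi>: "test_function \<phi>"
  shows "(LINT z|lborel. K i z * \<phi> (x - z)) = - iter_partial [i] \<phi> x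
    - (\<Sum>j\<in>UNIV. \<Sum>k\<in>UNIV. \<Sum>l\<in>UNIV.
        LINT s|lborel. remainder_weight i j k l s * iter_partial [l, k, j] \<phi> (x - snd s *\<^sub>R fst s))"
proof -
  define G where "G j k l s = remainder_weight i j k l s * iter_partial [l, k, j] \<phi> (x - snd s *\<^sub>R fst s)" for j k l s
  have [measurable]: "iter_partial is \<phi> \<in> borel_measurable borel" for "is"
    using test_function_measurable[OF \<phi>] .
  then have [measurable]: "\<phi> \<in> borel_measurable borel"
    using iter_partial.simps(1)[of \<phi>] by metis
  have [measurable]: "fst \<in> borel_measurable (borel :: ((real^'n) \<times> real) measure)"
    and [measurable]: "snd \<in> borel_measurable (borel :: ((real^'n) \<times> real) measure)"
    by (intro borel_measurable_continuous_onI continuous_intros)+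
  have G: "integrable (lborel \<Otimes>\<^sub>M lborel) (G j k l)" for j k l
  proof -
    obtain B r where B: "\<And>y. \<bar>iter_partial [l, k, j] \<phi> y\<bar> \<le> B"
      using test_function_bounds[OF \<phi>, of "[l, k, j]"] by metis
    have "integrable lborel (G j k l)"
    proof (rule Bochner_Integration.integrable_bound)
      show "integrable lborel (\<lambda>s. B * remainder_weight i j k l s)"
        using remainder_weight_integrable by simp
      show "G j k l \<in> borel_measurable lborel"
        unfolding G_def[abs_def] measurable_lborel1 by measurable
      show "AE s in lborel. norm (G j k l s) \<le> norm (B * remainder_weight i j k l s)"
      proof (rule AE_I2)
        fix s :: "(real^'n) \<times> real"
        have "\<bar>iter_partial [l, k, j] \<phi> (x - snd s *\<^sub>R fst s)\<bar> \<le> \<bar>B\<bar>"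
          by (rule order_trans[OF B abs_ge_self])
        then show "norm (G j k l s) \<le> norm (B * remainder_weight i j k l s)"
          unfolding G_def real_norm_def abs_mult mult.commute[of "\<bar>B\<bar>"] by (intro mult_left_mono) auto
      qed
    qed
    then show ?thesis
      by (simp add: lborel_prod)
  qed
  define T where "T z = K i z * \<phi> x
      - (\<Sum>j\<in>UNIV. K i z * z $ j * iter_partial [j] \<phi> x)
      + (\<Sum>j\<in>UNIV. \<Sum>k\<in>UNIV. K i z * (z $ j * z $ k) * (iter_partial [k, j] \<phi> x / 2))
      - (\<Sum>j\<in>UNIV. \<Sum>k\<in>UNIV. \<Sum>l\<in>UNIV. LINT t|lborel. G j k l (z, t))" for z
  have IG: "has_bochner_integral lborel (\<lambda>z. LINT t|lborel. G j k l (z, t)) (LINT s|lborel. G j k l s)" for j k l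
    using lborel_pair.integrable_fst'[OF G, of j k l] lborel_pair.integral_fst'[OF G, of j k l]
    by (simp add: has_bochner_integral_iff lborel_prod)
  have I0: "has_bochner_integral lborel (K i) 0"
    by (simp add: has_bochner_integral_iff K_integrable K_moment0)
  have I1: "has_bochner_integral lborel (\<lambda>z. K i z * z $ j) (if i = j then 1 else 0)" for j
    using K_moment1_integrable[of i j] K_moment1[of i j] by (simp only: has_bochner_integral_iff simp_thms)
  have I2: "has_bochner_integral lborel (\<lambda>z. K i z * (z $ j * z $ k)) 0" for j k
    using K_moment2_integrable[of i j k] K_moment2[of i j k] by (simp only: has_bochner_integral_iff simp_thms)
  have S0: "has_bochner_integral lborel (\<lambda>z. K i z * \<phi> x) (0 * \<phi> x)"
    by (rule has_bochner_integral_mult_left, rule I0)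
  have S1: "has_bochner_integral lborel (\<lambda>z. \<Sum>j\<in>UNIV. K i z * z $ j * iter_partial [j] \<phi> x)
      (\<Sum>j\<in>UNIV. (if i = j then 1 else 0) * iter_partial [j] \<phi> x)"
    by (rule has_bochner_integral_sum, rule has_bochner_integral_mult_left, rule I1)
  have S2: "has_bochner_integral lborel (\<lambda>z. \<Sum>j\<in>UNIV. \<Sum>k\<in>UNIV. K i z * (z $ j * z $ k) * (iter_partial [k, j] \<phi> x / 2))
      (\<Sum>j\<in>UNIV. \<Sum>k\<in>UNIV. 0 * (iter_partial [k, j] \<phi> x / 2))"
    by (rule has_bochner_integral_sum, rule has_bochner_integral_sum, rule has_bochner_integral_mult_left, rule I2)
  have S3: "has_bochner_integral lborel (\<lambda>z. \<Sum>j\<in>UNIV. \<Sum>k\<in>UNIV. \<Sum>l\<in>UNIV. LINT t|lborel. G j k l (z, t))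
      (\<Sum>j\<in>UNIV. \<Sum>k\<in>UNIV. \<Sum>l\<in>UNIV. LINT s|lborel. G j k l s)"
    by (rule has_bochner_integral_sum, rule has_bochner_integral_sum, rule has_bochner_integral_sum, rule IG)
  have "has_bochner_integral lborel T (0 * \<phi> x
      - (\<Sum>j\<in>UNIV. (if i = j then 1 else 0) * iter_partial [j] \<phi> x)
      + (\<Sum>j\<in>UNIV. \<Sum>k\<in>UNIV. 0 * (iter_partial [k, j] \<phi> x / 2))
      - (\<Sum>j\<in>UNIV. \<Sum>k\<in>UNIV. \<Sum>l\<in>UNIV. LINT s|lborel. G j k l s))"
    unfolding T_def[abs_def]
    by (rule has_bochner_integral_diff[OF has_bochner_integral_add[OF has_bochner_integral_diff[OF S0 S1] S2] S3])
  moreover have "(\<Sum>j\<in>UNIV. (if i = j then 1 else 0) * iter_partial [j] \<phi> x) = iter_partial [i] \<phi> x"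
    by (simp only: mult_if_delta sum.delta' finite if_True UNIV_I)
  ultimately have T: "has_bochner_integral lborel T (- iter_partial [i] \<phi> x
      - (\<Sum>j\<in>UNIV. \<Sum>k\<in>UNIV. \<Sum>l\<in>UNIV. LINT s|lborel. G j k l s))"
    by simp
  have "(LINT z|lborel. K i z * \<phi> (x - z)) = (LINT z|lborel. T z)"
  proof (rule integral_cong_AE)
    \<comment> \<open>The sums may be taken under the integral in \<open>t\<close> where all slices
      are integrable, so the comparison with \<open>T\<close> is made for almost every
      \<open>z\<close>.\<close>
    have "AE z in lborel. \<forall>j k l. integrable lborel (\<lambda>t. G j k l (z, t))"
      using lborel_pair.AE_integrable_fst'[OF G] by (simp only: AE_all_countable simp_thms)
    then show "AE z in lborel. K i z * \<phi> (x - z) = T z"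
    proof eventually_elim
      case (elim z)
      have "has_bochner_integral lborel (\<lambda>t. \<Sum>j\<in>UNIV. \<Sum>k\<in>UNIV. \<Sum>l\<in>UNIV. G j k l (z, t))
        (\<Sum>j\<in>UNIV. \<Sum>k\<in>UNIV. \<Sum>l\<in>UNIV. LINT t|lborel. G j k l (z, t))"
        using elim by (intro has_bochner_integral_sum has_bochner_integral_integrable) auto
      then have "(\<Sum>j\<in>UNIV. \<Sum>k\<in>UNIV. \<Sum>l\<in>UNIV. LINT t|lborel. G j k l (z, t))
          = (LINT t|lborel. (\<Sum>j\<in>UNIV. \<Sum>k\<in>UNIV. \<Sum>l\<in>UNIV. G j k l (z, t)))"
        by (rule has_bochner_integral_integral_eq[symmetric])
      also have "\<dots> = (LINT t|lborel. K i z * ((1 - t)^2 / 2 * indicator {0..1} t *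
        (\<Sum>j\<in>UNIV. \<Sum>k\<in>UNIV. \<Sum>l\<in>UNIV. z $ j * z $ k * z $ l * iter_partial [l, k, j] \<phi> (x - t *\<^sub>R z))))"
        unfolding G_def remainder_weight_def fst_conv snd_conv sum_distrib_left
        by (intro Bochner_Integration.integral_cong refl sum.cong) (simp only: mult_ac)
      also have "\<dots> = K i z * (LINT t|lborel. (1 - t)^2 / 2 * indicator {0..1} t *
        (\<Sum>j\<in>UNIV. \<Sum>k\<in>UNIV. \<Sum>l\<in>UNIV. z $ j * z $ k * z $ l * iter_partial [l, k, j] \<phi> (x - t *\<^sub>R z)))"
        by (rule integral_mult_right_zero)
      finally have R: "(\<Sum>j\<in>UNIV. \<Sum>k\<in>UNIV. \<Sum>l\<in>UNIV. LINT t|lborel. G j k l (z, t)) = \<dots>" .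
      show ?case
        unfolding taylor_along_line[OF \<phi>, of x z] T_def R
        by (simp only: distrib_left right_diff_distrib sum_distrib_left sum_divide_distrib mult.assoc times_divide_eq_right)
    qed
    show "T \<in> borel_measurable lborel"
      using T by (rule borel_measurable_has_bochner_integral)
  qed measurable
  also have "\<dots> = - iter_partial [i] \<phi> x - (\<Sum>j\<in>UNIV. \<Sum>k\<in>UNIV. \<Sum>l\<in>UNIV. LINT s|lborel. G j k l s)"
    using T by (rule has_bochner_integral_integral_eq)
  finally show ?thesis
    by (simp add: G_def)
qed

end

section \<open>Weak derivatives\<close>

lemma iter_partial_shift:
  fixes \<phi> :: "real^'n \<Rightarrow> real"
  assumes "test_function \<phi>"
  shows "iter_partial is (\<lambda>x. \<phi> (x - a)) = (\<lambda>x. iter_partial is \<phi> (x - a))"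
proof (induction "is")
  case (Cons i "is")
  have "partial i (\<lambda>x. iter_partial is \<phi> (x - a)) x = partial i (iter_partial is \<phi>) (x - a)" for x
  proof -
    have D: "(iter_partial is \<phi> has_derivative frechet_derivative (iter_partial is \<phi>) (at (x - a))) (at (x - a))"
      using test_function_differentiable[OF assms] by (simp add: frechet_derivative_works)
    have "((\<lambda>x. x - a) has_derivative (\<lambda>h. h)) (at x)"
      by (auto intro!: derivative_eq_intros)
    from partial_eq[OF has_derivative_compose[OF this D]] show ?thesis
      by (simp add: partial_def)
  qed
  with Cons show ?case by auto
qed simp

lemma test_function_shift:
  fixes \<phi> :: "real^'n \<Rightarrow> real"
  assumes \<phi>: "test_function \<phi>"
  shows "test_function (\<lambda>x. \<phi> (x - a))"
  unfolding test_function_def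
proof (intro conjI allI)
  fix "is" and x
  have "((\<lambda>x. x - a) has_derivative (\<lambda>h. h)) (at x)"
    by (auto intro!: derivative_eq_intros)
  then show "iter_partial is (\<lambda>x. \<phi> (x - a)) differentiable (at x)"
    unfolding iter_partial_shift[OF \<phi>]
    using has_derivative_compose test_function_differentiable[OF \<phi>, of "is" "x - a"]
    unfolding differentiable_def by blast
next
  have "{x. \<phi> (x - a) \<noteq> 0} = (+) a ` {x. \<phi> x \<noteq> 0}"
  proof (intro set_eqI iffI)
    fix x assume "x \<in> {x. \<phi> (x - a) \<noteq> 0}"
    then show "x \<in> (+) a ` {x. \<phi> x \<noteq> 0}"
      by (intro image_eqI[where x = "x - a"]) auto
  qed auto
  then show "compact (closure {x. \<phi> (x - a) \<noteq> 0})"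
    using \<phi> by (simp add: closure_translation compact_translation test_function_def)
qed

lemma lebesgue_integral_representative:
  fixes u u' :: "'a::euclidean_space \<Rightarrow> 'b::euclidean_space"
  assumes [measurable]: "u' \<in> borel_measurable borel" "\<phi> \<in> borel_measurable borel"
    and eq: "AE x in lborel. u x = u' x"
  shows "(LINT x|lebesgue. \<phi> x *\<^sub>R u x) = (LINT x|lborel. \<phi> x *\<^sub>R u' x)"
proof -
  have eq': "AE x in lborel. \<phi> x *\<^sub>R u' x = \<phi> x *\<^sub>R u x"
    using eq by eventually_elim simp
  have m: "(\<lambda>x. \<phi> x *\<^sub>R u' x) \<in> borel_measurable lborel"
    by measurable
  then have m': "(\<lambda>x. \<phi> x *\<^sub>R u' x) \<in> borel_measurable lebesgue"
    by (rule measurable_completion)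
  have "(LINT x|lebesgue. \<phi> x *\<^sub>R u' x) = (LINT x|lebesgue. \<phi> x *\<^sub>R u x)"
    using m' lebesgue_measurable_AE_cong[OF m' eq'] AE_completion[OF eq'] by (rule integral_cong_AE)
  then show ?thesis
    using integral_completion[OF m] by simp
qed

lemma weak_deriv_representative:
  fixes u u' g :: "real^'n \<Rightarrow> 'b::euclidean_space"
  assumes w: "has_weak_deriv (count_list is) u g"
    and u': "borel_loc_integrable u'" "AE x in lborel. u x = u' x"
  obtains g' where "borel_loc_integrable g'" "AE x in lborel. g x = g' x"
    "\<And>\<phi>. test_function \<phi> \<Longrightarrow> (LINT x|lborel. iter_partial is \<phi> x *\<^sub>R u' x)
      = (-1) ^ length is *\<^sub>R (LINT x|lborel. \<phi> x *\<^sub>R g' x)"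
proof -
  have "locally_integrable g"
    using w by (simp add: has_weak_deriv_def)
  then obtain g' where g': "borel_loc_integrable g'" "AE x in lborel. g x = g' x"
    by (rule locally_integrable_representative)
  have len: "(\<Sum>i\<in>UNIV. count_list is i) = length is"
    by (rule sum_count_set) auto
  have "(LINT x|lborel. iter_partial is \<phi> x *\<^sub>R u' x) = (-1) ^ length is *\<^sub>R (LINT x|lborel. \<phi> x *\<^sub>R g' x)"
    if \<phi>: "test_function \<phi>" for \<phi>
  proof -
    have "(LINT x|lebesgue. iter_partial is \<phi> x *\<^sub>R u x) = (-1) ^ length is *\<^sub>R (LINT x|lebesgue. \<phi> x *\<^sub>R g x)"
      using w \<phi> len unfolding has_weak_deriv_def by metis
    moreover have "(LINT x|lebesgue. iter_partial is \<phi> x *\<^sub>R u x) = (LINT x|lborel. iter_partial is \<phi> x *\<^sub>R u' x)"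
      using u' test_function_measurable[OF \<phi>]
      by (intro lebesgue_integral_representative) (auto simp: borel_loc_integrable_def)
    moreover have "(LINT x|lebesgue. \<phi> x *\<^sub>R g x) = (LINT x|lborel. \<phi> x *\<^sub>R g' x)"
      using g' test_function_measurable[OF \<phi>, of "[]"]
      by (intro lebesgue_integral_representative) (auto simp: borel_loc_integrable_def)
    ultimately show ?thesis by simp
  qed
  with g' that show ?thesis by blast
qed

lemma test_function_integrable:
  fixes f :: "real^'n \<Rightarrow> 'b::euclidean_space"
  assumes "test_function \<phi>" "borel_loc_integrable f"
  shows "integrable lborel (\<lambda>x. iter_partial is \<phi> x *\<^sub>R f x)"
proof -
  obtain B r where "\<And>x. \<bar>iter_partial is \<phi> x\<bar> \<le> B" "\<And>x. iter_partial is \<phi> x \<noteq> 0 \<Longrightarrow> norm x \<le> r"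
    using test_function_bounds[OF assms(1), where ?is = "is"] by metis
  then show ?thesis
    using borel_loc_integrable_bounded_support[OF assms(2) test_function_measurable[OF assms(1)]] by blast
qed

text \<open>The common sign \<open>(-1) ^ length is\<close> cancels, and the fundamental lemma
  applies to the difference of the Borel representatives.\<close>

lemma weak_deriv_unique:
  fixes u g1 g2 :: "real^'n \<Rightarrow> 'b::euclidean_space"
  assumes w1: "has_weak_deriv (count_list is) u g1" and w2: "has_weak_deriv (count_list is) u g2"
  shows "AE x in lborel. g1 x = g2 x"
proof -
  have "locally_integrable u"
    using w1 by (simp add: has_weak_deriv_def)
  then obtain u' where u': "borel_loc_integrable u'" "AE x in lborel. u x = u' x"
    by (rule locally_integrable_representative)
  obtain h1 where h1: "borel_loc_integrable h1" "AE x in lborel. g1 x = h1 x"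
    "\<And>\<phi>. test_function \<phi> \<Longrightarrow> (LINT x|lborel. iter_partial is \<phi> x *\<^sub>R u' x)
      = (-1) ^ length is *\<^sub>R (LINT x|lborel. \<phi> x *\<^sub>R h1 x)"
    using weak_deriv_representative[OF w1 u'] by blast
  obtain h2 where h2: "borel_loc_integrable h2" "AE x in lborel. g2 x = h2 x"
    "\<And>\<phi>. test_function \<phi> \<Longrightarrow> (LINT x|lborel. iter_partial is \<phi> x *\<^sub>R u' x)
      = (-1) ^ length is *\<^sub>R (LINT x|lborel. \<phi> x *\<^sub>R h2 x)"
    using weak_deriv_representative[OF w2 u'] by blast
  have "AE x in lborel. h1 x - h2 x = 0"
  proof (rule AE_zero_if_test_integrals_zero)
    show "borel_loc_integrable (\<lambda>x. h1 x - h2 x)"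
      using h1 h2 by (intro borel_loc_integrable_diff)
    fix \<phi> :: "real^'n \<Rightarrow> real" assume \<phi>: "test_function \<phi>"
    have "(-1) ^ length is *\<^sub>R (LINT x|lborel. \<phi> x *\<^sub>R h1 x) = (-1::real) ^ length is *\<^sub>R (LINT x|lborel. \<phi> x *\<^sub>R h2 x)"
      using h1(3)[OF \<phi>] h2(3)[OF \<phi>] by simp
    then have eq: "(LINT x|lborel. \<phi> x *\<^sub>R h1 x) = (LINT x|lborel. \<phi> x *\<^sub>R h2 x)"
      by (subst (asm) real_vector.scale_cancel_left) simp
    have "(LINT x|lborel. \<phi> x *\<^sub>R h1 x - \<phi> x *\<^sub>R h2 x) = (LINT x|lborel. \<phi> x *\<^sub>R h1 x) - (LINT x|lborel. \<phi> x *\<^sub>R h2 x)"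
      using test_function_integrable[OF \<phi> h1(1), of "[]"] test_function_integrable[OF \<phi> h2(1), of "[]"]
      by (intro Bochner_Integration.integral_diff) auto
    with eq show "(LINT x|lborel. \<phi> x *\<^sub>R (h1 x - h2 x)) = 0"
      by (simp add: scaleR_diff_right)
  qed
  with h1(2) h2(2) show ?thesis
    by eventually_elim simp
qed

text \<open>\<open>weak_deriv\<close> picks some weak derivative, while \<open>sobolev\<close>
  provides one that lies in \<open>Lq\<close>; uniqueness carries the \<open>Lq\<close> bound over
  to the chosen one. Its norm is one of the terms combined in \<open>sobolev_norm\<close>.\<close>

lemma sobolev_weak_deriv:
  fixes u :: "real^'n \<Rightarrow> 'b::euclidean_space"
  assumes q: "1 \<le> q" and u: "u \<in> sobolev k q" and len: "length is \<le> k"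
  shows "has_weak_deriv (count_list is) u (weak_deriv (count_list is) u)"
    and "Lq_bounded q (weak_deriv (count_list is) u) (sobolev_norm k q u)"
proof -
  let ?\<alpha> = "count_list is" and ?g = "weak_deriv (count_list is) u"
  \<comment> \<open>Finiteness gives \<open>sobolev_norm\<close> its meaning: a sum over an infinite
    set would be 0 by convention.\<close>
  have fin: "finite (multi_indices k :: ('n \<Rightarrow> nat) set)"
  proof (rule finite_subset)
    show "multi_indices k \<subseteq> (UNIV :: 'n set) \<rightarrow>\<^sub>E {..k}"
    proof
      fix \<alpha> :: "'n \<Rightarrow> nat" assume \<alpha>: "\<alpha> \<in> multi_indices k"
      have "\<alpha> i \<le> k" for i
      proof -
        have "\<alpha> i \<le> (\<Sum>i\<in>UNIV. \<alpha> i)"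
          by (rule member_le_sum) auto
        also have "\<dots> \<le> k"
          using \<alpha> by (simp add: multi_indices_def)
        finally show ?thesis .
      qed
      then show "\<alpha> \<in> UNIV \<rightarrow>\<^sub>E {..k}"
        by (simp add: PiE_def)
    qed
    show "finite ((UNIV :: 'n set) \<rightarrow>\<^sub>E {..k})"
      by (intro finite_PiE) auto
  qed
  have "(\<Sum>i\<in>UNIV. count_list is i) = length is"
    by (rule sum_count_set) auto
  then have \<alpha>: "?\<alpha> \<in> multi_indices k"
    using len by (simp add: multi_indices_def)
  then obtain g where g: "g \<in> Lq q" "has_weak_deriv ?\<alpha> u g"
    using u by (auto simp: sobolev_def)
  show w: "has_weak_deriv ?\<alpha> u ?g"
    unfolding weak_deriv_def by (rule someI[of "has_weak_deriv ?\<alpha> u", OF g(2)])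
  have "Lq_bounded q ?g (Lq_norm q g)"
    by (rule Lq_bounded_AE_cong[OF Lq_bounded_Lq_norm[OF q g(1)] weak_deriv_unique[OF g(2) w]])
  then have "?g \<in> Lq q"
    by (rule Lq_boundedD[OF q])
  then have B: "Lq_bounded q ?g (Lq_norm q ?g)"
    by (rule Lq_bounded_Lq_norm[OF q])
  have "Lq_norm q ?g \<le> sobolev_norm k q u"
  proof (cases "q = \<infinity>")
    case True
    then show ?thesis
      using \<alpha> fin by (auto simp: sobolev_norm_def intro!: Max_ge)
  next
    case False
    then obtain r where r: "q = ereal r" "1 \<le> r"
      using q by (cases q) auto
    have "Lq_norm q ?g powr r \<le> (\<Sum>\<alpha>\<in>multi_indices k. Lq_norm q (weak_deriv \<alpha> u) powr r)"
      using \<alpha> fin by (intro member_le_sum) auto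
    then have "(Lq_norm q ?g powr r) powr (1 / r)
        \<le> (\<Sum>\<alpha>\<in>multi_indices k. Lq_norm q (weak_deriv \<alpha> u) powr r) powr (1 / r)"
      using r by (intro powr_mono2) auto
    moreover have "(Lq_norm q ?g powr r) powr (1 / r) = Lq_norm q ?g"
      using B r by (simp add: powr_powr Lq_bounded_def)
    ultimately show ?thesis
      using r by (simp add: sobolev_norm_def)
  qed
  with B show "Lq_bounded q ?g (sobolev_norm k q u)"
    by (rule Lq_bounded_mono[OF q])
qed

section \<open>The consistency error\<close>

context normalized_kernel
begin

lemma K_shift_average: "shift_average lborel (K i) (\<lambda>z. z) \<delta>"
proof
  show "norm z \<le> \<delta>" if "K i z \<noteq> 0" for z
    using K_support[OF that] by simp
qed (use K_integrable in auto)

lemma remainder_shift_average: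
  "shift_average lborel (remainder_weight i j k l) (\<lambda>s. snd s *\<^sub>R fst s) \<delta>"
proof
  show "norm (snd s *\<^sub>R fst s) \<le> \<delta>" if "remainder_weight i j k l s \<noteq> 0" for s
  proof -
    have "K i (fst s) \<noteq> 0" and s: "snd s \<in> {0..1}"
      using that by (auto simp: remainder_weight_def indicator_eq_0_iff)
    then have "\<bar>snd s\<bar> * norm (fst s) \<le> 1 * \<delta>"
      using K_support by (intro mult_mono) (auto simp: less_imp_le)
    then show ?thesis by simp
  qed
  have "(\<lambda>s::(real^'n) \<times> real. snd s *\<^sub>R fst s) \<in> borel_measurable borel"
    by (intro borel_measurable_continuous_onI continuous_intros)
  then show "(\<lambda>s::(real^'n) \<times> real. snd s *\<^sub>R fst s) \<in> borel_measurable lborel"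
    by simp
qed (rule remainder_weight_integrable)

abbreviation average_K :: "'n \<Rightarrow> (real^'n \<Rightarrow> 'b::euclidean_space) \<Rightarrow> real^'n \<Rightarrow> 'b" where
  "average_K i \<equiv> shift_average.average lborel (K i) (\<lambda>z. z)"

abbreviation remainder :: "'n \<Rightarrow> 'n \<Rightarrow> 'n \<Rightarrow> 'n \<Rightarrow> (real^'n \<Rightarrow> 'b::euclidean_space) \<Rightarrow> real^'n \<Rightarrow> 'b" where
  "remainder i j k l \<equiv> shift_average.average lborel (remainder_weight i j k l) (\<lambda>s. snd s *\<^sub>R fst s)"

text \<open>Averaging over shifts commutes with weak differentiation. For each fixed shift the
  translated \<open>\<phi>\<close> is again a test function, so the three derivatives pass from it
  to \<open>u'\<close> with sign \<open>(-1)^3\<close>; integrating over the shifts gives the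
  average of \<open>g'\<close>.\<close>

lemma weak_deriv_remainder:
  fixes u' g' :: "real^'n \<Rightarrow> 'b::euclidean_space"
  assumes u': "borel_loc_integrable u'" and g': "borel_loc_integrable g'" and \<phi>: "test_function \<phi>"
    and weak: "\<And>\<phi>. test_function \<phi> \<Longrightarrow> (LINT x|lborel. iter_partial [l, k, j] \<phi> x *\<^sub>R u' x)
      = - (LINT x|lborel. \<phi> x *\<^sub>R g' x)"
  shows "(LINT x|lborel. (LINT s|lborel. remainder_weight i j k l s * iter_partial [l, k, j] \<phi> (x - snd s *\<^sub>R fst s)) *\<^sub>R u' x)
    = - (LINT x|lborel. \<phi> x *\<^sub>R remainder i j k l g' x)" (is "?L = _")
    and "integrable lborel (\<lambda>x. (LINT s|lborel. remainder_weight i j k l s * iter_partial [l, k, j] \<phi> (x - snd s *\<^sub>R fst s)) *\<^sub>R u' x)"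
proof -
  let ?h = "remainder_weight i j k l" and ?\<tau> = "\<lambda>s::(real^'n) \<times> real. snd s *\<^sub>R fst s"
  let ?\<psi> = "iter_partial [l, k, j] \<phi>"
  note R = remainder_shift_average[of i j k l]
  have meas [measurable]: "iter_partial is \<phi> \<in> borel_measurable borel" for "is"
    using test_function_measurable[OF \<phi>] .
  have \<phi>m [measurable]: "\<phi> \<in> borel_measurable borel"
    using meas[of "[]"] by simp
  have [measurable]: "u' \<in> borel_measurable borel" "g' \<in> borel_measurable borel"
    using u' g' by (auto simp: borel_loc_integrable_def)
  obtain B r where B: "\<And>x. \<bar>?\<psi> x\<bar> \<le> B" and r: "\<And>x. ?\<psi> x \<noteq> 0 \<Longrightarrow> norm x \<le> r"
    using test_function_bounds[OF \<phi>, where ?is = "[l, k, j]"] by metis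
  obtain B' r' where B': "\<And>x. \<bar>\<phi> x\<bar> \<le> B'" and r': "\<And>x. \<phi> x \<noteq> 0 \<Longrightarrow> norm x \<le> r'"
    using test_function_bounds[OF \<phi>, where ?is = "[]"] by (metis iter_partial.simps(1))
  show "integrable lborel (\<lambda>x. (LINT s|lborel. ?h s * ?\<psi> (x - ?\<tau> s)) *\<^sub>R u' x)"
    by (rule shift_average.average_adjoint_integrable[OF R u' meas B r])
  \<comment> \<open>The shift is moved onto \<open>\<phi>\<close>, the weak derivative is used
    there, and the shift is moved back.\<close>
  have slice: "(LINT x|lborel. ?\<psi> x *\<^sub>R u' (x + ?\<tau> s)) = - (LINT x|lborel. \<phi> x *\<^sub>R g' (x + ?\<tau> s))" for s
  proof -
    have "(LINT x|lborel. ?\<psi> x *\<^sub>R u' (x + ?\<tau> s)) = (LINT x|lborel. ?\<psi> (x - ?\<tau> s) *\<^sub>R u' x)"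
    proof -
      have "(\<lambda>x. ?\<psi> (x - ?\<tau> s) *\<^sub>R u' x) \<in> borel_measurable borel"
        by (intro borel_measurable_scaleR measurable_compose[OF _ meas]) measurable
      from integral_translation[OF this, of "?\<tau> s"] show ?thesis
        by (simp only: add_diff_cancel)
    qed
    also have "\<dots> = (LINT x|lborel. iter_partial [l, k, j] (\<lambda>x. \<phi> (x - ?\<tau> s)) x *\<^sub>R u' x)"
      unfolding iter_partial_shift[OF \<phi>] ..
    also have "\<dots> = - (LINT x|lborel. \<phi> (x - ?\<tau> s) *\<^sub>R g' x)"
      by (rule weak[OF test_function_shift[OF \<phi>]])
    also have "(LINT x|lborel. \<phi> (x - ?\<tau> s) *\<^sub>R g' x) = (LINT x|lborel. \<phi> x *\<^sub>R g' (x + ?\<tau> s))"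
    proof -
      have "(\<lambda>x. \<phi> (x - ?\<tau> s) *\<^sub>R g' x) \<in> borel_measurable borel"
        by (intro borel_measurable_scaleR measurable_compose[OF _ \<phi>m]) measurable
      from integral_translation[OF this, of "?\<tau> s"] show ?thesis
        by (simp only: add_diff_cancel)
    qed
    finally show ?thesis .
  qed
  have "?L = (LINT x|lborel. ?\<psi> x *\<^sub>R remainder i j k l u' x)"
    by (rule shift_average.average_adjoint(1)[OF R u' meas B r, symmetric])
  also have "\<dots> = (LINT s|lborel. ?h s *\<^sub>R (LINT x|lborel. ?\<psi> x *\<^sub>R u' (x + ?\<tau> s)))"
    by (rule shift_average.average_adjoint(2)[OF R u' meas B r])
  also have "\<dots> = - (LINT s|lborel. ?h s *\<^sub>R (LINT x|lborel. \<phi> x *\<^sub>R g' (x + ?\<tau> s)))"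
    unfolding slice by (simp only: scaleR_minus_right Bochner_Integration.integral_minus)
  also have "(LINT s|lborel. ?h s *\<^sub>R (LINT x|lborel. \<phi> x *\<^sub>R g' (x + ?\<tau> s))) = (LINT x|lborel. \<phi> x *\<^sub>R remainder i j k l g' x)"
    by (rule shift_average.average_adjoint(2)[OF R g' \<phi>m B' r', symmetric])
  finally show "?L = - (LINT x|lborel. \<phi> x *\<^sub>R remainder i j k l g' x)" .
qed

text \<open>Tested with \<open>\<phi>\<close>, the average becomes \<open>u'\<close> against
  \<open>K_test_function\<close>. Both terms on its right carry a minus sign, and passing one or
  three derivatives to \<open>u'\<close> gives another, so \<open>g1\<close> and the remainders of
  \<open>g3\<close> appear with a plus.\<close>

lemma average_K_expansion:
  fixes u' :: "real^'n \<Rightarrow> 'b::euclidean_space"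
  assumes u': "borel_loc_integrable u'"
    and g1: "borel_loc_integrable g1"
    and weak1: "\<And>\<phi>. test_function \<phi> \<Longrightarrow> (LINT x|lborel. iter_partial [i] \<phi> x *\<^sub>R u' x)
      = - (LINT x|lborel. \<phi> x *\<^sub>R g1 x)"
    and g3: "\<And>j k l. borel_loc_integrable (g3 j k l)"
    and weak3: "\<And>\<phi> j k l. test_function \<phi> \<Longrightarrow> (LINT x|lborel. iter_partial [l, k, j] \<phi> x *\<^sub>R u' x)
      = - (LINT x|lborel. \<phi> x *\<^sub>R g3 j k l x)"
  shows "AE x in lborel. average_K i u' x - g1 x
    = (\<Sum>j\<in>UNIV. \<Sum>k\<in>UNIV. \<Sum>l\<in>UNIV. remainder i j k l (g3 j k l) x)"
proof -
  let ?R = "\<lambda>x. \<Sum>j\<in>UNIV. \<Sum>k\<in>UNIV. \<Sum>l\<in>UNIV. remainder i j k l (g3 j k l) x"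
  have locK: "borel_loc_integrable (average_K i u')"
    by (rule shift_average.average_loc_integrable[OF K_shift_average u'])
  have locR: "borel_loc_integrable (remainder i j k l (g3 j k l))" for j k l
    by (rule shift_average.average_loc_integrable[OF remainder_shift_average g3])
  have "AE x in lborel. average_K i u' x - g1 x - ?R x = 0"
  proof (rule AE_zero_if_test_integrals_zero)
    show "borel_loc_integrable (\<lambda>x. average_K i u' x - g1 x - ?R x)"
      by (intro borel_loc_integrable_diff borel_loc_integrable_sum locK g1 locR)
    fix \<phi> :: "real^'n \<Rightarrow> real" assume \<phi>: "test_function \<phi>"
    have int: "integrable lborel (\<lambda>x. \<phi> x *\<^sub>R f x)" if "borel_loc_integrable f" for f :: "real^'n \<Rightarrow> 'b"
      using test_function_integrable[OF \<phi> that, of "[]"] by simp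
    have \<phi>m: "\<phi> \<in> borel_measurable borel"
      using test_function_measurable[OF \<phi>, of "[]"] by simp
    obtain B r where B: "\<And>x. \<bar>\<phi> x\<bar> \<le> B" and r: "\<And>x. \<phi> x \<noteq> 0 \<Longrightarrow> norm x \<le> r"
      using test_function_bounds[OF \<phi>, where ?is = "[]"] by (metis iter_partial.simps(1))
    define W where "W j k l x = (LINT s|lborel. remainder_weight i j k l s * iter_partial [l, k, j] \<phi> (x - snd s *\<^sub>R fst s))" for j k l x
    have W: "has_bochner_integral lborel (\<lambda>x. W j k l x *\<^sub>R u' x) (- (LINT x|lborel. \<phi> x *\<^sub>R remainder i j k l (g3 j k l) x))" for j k l
      using weak_deriv_remainder[OF u' g3 \<phi> weak3, of i j k l] by (simp only: W_def has_bochner_integral_iff simp_thms)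
    have W': "has_bochner_integral lborel (\<lambda>x. \<Sum>j\<in>UNIV. \<Sum>k\<in>UNIV. \<Sum>l\<in>UNIV. W j k l x *\<^sub>R u' x)
        (\<Sum>j\<in>UNIV. \<Sum>k\<in>UNIV. \<Sum>l\<in>UNIV. - (LINT x|lborel. \<phi> x *\<^sub>R remainder i j k l (g3 j k l) x))"
      by (rule has_bochner_integral_sum, rule has_bochner_integral_sum, rule has_bochner_integral_sum, rule W)
    have D: "has_bochner_integral lborel (\<lambda>x. iter_partial [i] \<phi> x *\<^sub>R u' x) (- (LINT x|lborel. \<phi> x *\<^sub>R g1 x))"
      using weak1[OF \<phi>] test_function_integrable[OF \<phi> u', of "[i]"] by (simp only: has_bochner_integral_iff simp_thms)
    have "(LINT x|lborel. \<phi> x *\<^sub>R average_K i u' x) = (LINT x|lborel. (LINT z|lborel. K i z * \<phi> (x - z)) *\<^sub>R u' x)"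
      by (rule shift_average.average_adjoint(1)[OF K_shift_average u' \<phi>m B r])
    also have "\<dots> = (LINT x|lborel. 0 - iter_partial [i] \<phi> x *\<^sub>R u' x - (\<Sum>j\<in>UNIV. \<Sum>k\<in>UNIV. \<Sum>l\<in>UNIV. W j k l x *\<^sub>R u' x))"
      unfolding K_test_function[OF \<phi>] W_def[symmetric]
      by (simp only: scaleR_diff_left scaleR_minus_left scaleR_sum_left diff_0)
    also have "\<dots> = 0 - - (LINT x|lborel. \<phi> x *\<^sub>R g1 x)
        - (\<Sum>j\<in>UNIV. \<Sum>k\<in>UNIV. \<Sum>l\<in>UNIV. - (LINT x|lborel. \<phi> x *\<^sub>R remainder i j k l (g3 j k l) x))"
      by (rule has_bochner_integral_integral_eq,
          rule has_bochner_integral_diff[OF has_bochner_integral_diff[OF has_bochner_integral_zero D] W'])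
    finally have I: "(LINT x|lborel. \<phi> x *\<^sub>R average_K i u' x) = (LINT x|lborel. \<phi> x *\<^sub>R g1 x)
        + (\<Sum>j\<in>UNIV. \<Sum>k\<in>UNIV. \<Sum>l\<in>UNIV. (LINT x|lborel. \<phi> x *\<^sub>R remainder i j k l (g3 j k l) x))"
      by (simp only: sum_negf) simp
    have "has_bochner_integral lborel (\<lambda>x. \<phi> x *\<^sub>R average_K i u' x - \<phi> x *\<^sub>R g1 x
        - (\<Sum>j\<in>UNIV. \<Sum>k\<in>UNIV. \<Sum>l\<in>UNIV. \<phi> x *\<^sub>R remainder i j k l (g3 j k l) x))
      ((LINT x|lborel. \<phi> x *\<^sub>R average_K i u' x) - (LINT x|lborel. \<phi> x *\<^sub>R g1 x)
        - (\<Sum>j\<in>UNIV. \<Sum>k\<in>UNIV. \<Sum>l\<in>UNIV. (LINT x|lborel. \<phi> x *\<^sub>R remainder i j k l (g3 j k l) x)))"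
      by (rule has_bochner_integral_diff, rule has_bochner_integral_diff,
          rule has_bochner_integral_integrable[OF int[OF locK]],
          rule has_bochner_integral_integrable[OF int[OF g1]],
          rule has_bochner_integral_sum, rule has_bochner_integral_sum, rule has_bochner_integral_sum,
          rule has_bochner_integral_integrable[OF int[OF locR]])
    from has_bochner_integral_integral_eq[OF this]
    show "(LINT x|lborel. \<phi> x *\<^sub>R (average_K i u' x - g1 x - ?R x)) = 0"
      unfolding I scaleR_diff_right scaleR_sum_right by simp
  qed
  then show ?thesis
    by eventually_elim simp
qed

text \<open>The subtracted value at \<open>x\<close> contributes a multiple of the mean of
  \<open>K i\<close>, which is 0, so the nonlocal integral is the plain average. As that value
  enters pointwise, \<open>x\<close> must avoid the null set where \<open>u\<close> and
  \<open>u'\<close> differ.\<close>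

lemma nonlocal_representative:
  fixes u u' :: "real^'n \<Rightarrow> 'b::euclidean_space"
  assumes u': "borel_loc_integrable u'" and eq: "AE x in lborel. u x = u' x"
  shows "AE x in lborel. \<forall>i. has_bochner_integral lebesgue
    (\<lambda>y. indicator (horizon \<delta> x) y *\<^sub>R ((\<omega> (y - x) * unit_dir x y $ i) *\<^sub>R (u y - u x))) (average_K i u' x)"
proof -
  have um[measurable]: "u' \<in> borel_measurable borel"
    using u' by (simp add: borel_loc_integrable_def)
  have "AE x in lborel. integrable lborel (\<lambda>z. K i z *\<^sub>R u' (x + z))" for i
    by (rule shift_average.average_AE_integrable[OF K_shift_average u'])
  then have "AE x in lborel. \<forall>i. integrable lborel (\<lambda>z. K i z *\<^sub>R u' (x + z))"
    by (simp only: AE_all_countable simp_thms)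
  with eq show ?thesis
  proof eventually_elim
    case (elim x)
    show ?case
    proof
      fix i
      have "has_bochner_integral lborel (\<lambda>z. K i z *\<^sub>R u' (x + z) - K i z *\<^sub>R u' x)
          (average_K i u' x - (LINT z|lborel. K i z) *\<^sub>R u' x)"
        unfolding shift_average.average_def[OF K_shift_average]
        by (rule has_bochner_integral_diff, rule has_bochner_integral_integrable, use elim in blast,
            rule has_bochner_integral_scaleR_left, rule has_bochner_integral_integrable, rule K_integrable)
      then have z: "has_bochner_integral lborel (\<lambda>z. K i z *\<^sub>R (u' (x + z) - u' x)) (average_K i u' x)"
        by (simp add: K_moment0 scaleR_diff_right)
      define f where "f y = K i (y - x) *\<^sub>R (u' y - u' x)" for y
      have f[measurable]: "f \<in> borel_measurable borel"
        unfolding f_def[abs_def] by measurable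
      have "f (z + x) = K i z *\<^sub>R (u' (x + z) - u' x)" for z
        by (simp add: f_def add.commute)
      with z have "integrable lborel (\<lambda>z. f (z + x))" "(LINT z|lborel. f (z + x)) = average_K i u' x"
        by (simp_all only: has_bochner_integral_iff)
      then have "integrable lborel f" "(LINT z|lborel. f z) = average_K i u' x"
        by (simp_all only: integrable_translation_iff[OF f] integral_translation[OF f])
      then have F: "has_bochner_integral lebesgue f (average_K i u' x)"
        using f by (simp add: has_bochner_integral_iff integrable_completion integral_completion)
      let ?I = "\<lambda>y. indicator (horizon \<delta> x) y *\<^sub>R ((\<omega> (y - x) * unit_dir x y $ i) *\<^sub>R (u y - u x))"
      \<comment> \<open>\<open>\<omega> (y - x)\<close> vanishes off the horizon.\<close>
      have Ieq: "indicator (horizon \<delta> x) y *\<^sub>R ((\<omega> (y - x) * unit_dir x y $ i) *\<^sub>R w) = K i (y - x) *\<^sub>R w"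
        for y and w :: 'b
        using \<omega>_support[of "y - x"]
        by (cases "\<omega> (y - x) = 0") (auto simp: horizon_def direction_kernel_def unit_dir_def divide_inverse mult.commute)
      have ae: "AE y in lborel. f y = ?I y"
        using eq by eventually_elim (simp only: f_def Ieq elim(1))
      have fm: "f \<in> borel_measurable lebesgue"
        using f by (intro measurable_completion) simp
      show "has_bochner_integral lebesgue ?I (average_K i u' x)"
        using F has_bochner_integral_cong_AE[OF fm lebesgue_measurable_AE_cong[OF fm ae] AE_completion[OF ae]]
        by blast
    qed
  qed
qed

text \<open>The divergence, gradient and curl are \<open>\<Sum>i. L i (\<partial>\<^sub>i u)\<close> with \<open>L i w\<close> equal to
  \<open>w $ i\<close>, \<open>w *\<^sub>R axis i 1\<close> and \<open>axis i 1 \<times> w\<close> respectively.\<close>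

lemma nonlocal_estimate:
  fixes u :: "real^'n \<Rightarrow> 'b::euclidean_space" and L :: "'n \<Rightarrow> 'b \<Rightarrow> 'c::euclidean_space"
  assumes q: "1 \<le> q" and u: "u \<in> sobolev 3 q"
    and L: "\<And>i. bounded_linear (L i)" and L_le: "\<And>i w. norm (L i w) \<le> norm w"
    and I: "\<And>x y. I x y = (\<Sum>i\<in>UNIV. (\<omega> (y - x) * unit_dir x y $ i) *\<^sub>R L i (u y - u x))"
    and D: "\<And>x. D x = (\<Sum>i\<in>UNIV. L i (weak_partial i u x))"
  shows "(AE x in lebesgue. set_integrable lebesgue (horizon \<delta> x) (I x)) \<and>
    (\<lambda>x. (LINT y:horizon \<delta> x|lebesgue. I x y) - D x) \<in> Lq q \<and>
    Lq_norm q (\<lambda>x. (LINT y:horizon \<delta> x|lebesgue. I x y) - D x) \<le> real CARD('n)^9 * \<delta>^2 * sobolev_norm 3 q u"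
proof -
  let ?S = "sobolev_norm 3 q u"
  have "Lq_bounded q (weak_deriv (count_list []) u) ?S"
    using sobolev_weak_deriv(2)[OF q u, of "[]"] by simp
  then have S: "0 \<le> ?S"
    by (simp add: Lq_bounded_def)
  have "has_weak_deriv (count_list []) u (weak_deriv (count_list []) u)"
    using sobolev_weak_deriv(1)[OF q u, of "[]"] by simp
  then have "locally_integrable u"
    by (simp add: has_weak_deriv_def)
  then obtain u' where u': "borel_loc_integrable u'" "AE x in lborel. u x = u' x"
    by (rule locally_integrable_representative)
  have rep: "\<exists>g'. borel_loc_integrable g' \<and> (AE x in lborel. weak_deriv (count_list is) u x = g' x) \<and>
    (\<forall>\<phi>. test_function \<phi> \<longrightarrow> (LINT x|lborel. iter_partial is \<phi> x *\<^sub>R u' x)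
      = (-1) ^ length is *\<^sub>R (LINT x|lborel. \<phi> x *\<^sub>R g' x))" if "length is \<le> 3" for "is"
    by (rule weak_deriv_representative[OF sobolev_weak_deriv(1)[OF q u that] u']) blast
  then have "\<forall>is. \<exists>g'. length is \<le> 3 \<longrightarrow> borel_loc_integrable g' \<and> (AE x in lborel. weak_deriv (count_list is) u x = g' x) \<and>
    (\<forall>\<phi>. test_function \<phi> \<longrightarrow> (LINT x|lborel. iter_partial is \<phi> x *\<^sub>R u' x)
      = (-1) ^ length is *\<^sub>R (LINT x|lborel. \<phi> x *\<^sub>R g' x))"
    by blast
  \<comment> \<open>One Borel representative is fixed for each list, so that the expansion and the
    norm bound speak about the same functions.\<close>
  from choice[OF this] obtain G where GG: "\<forall>is. length is \<le> 3 \<longrightarrow> borel_loc_integrable (G is) \<and>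
    (AE x in lborel. weak_deriv (count_list is) u x = G is x) \<and>
    (\<forall>\<phi>. test_function \<phi> \<longrightarrow> (LINT x|lborel. iter_partial is \<phi> x *\<^sub>R u' x)
      = (-1) ^ length is *\<^sub>R (LINT x|lborel. \<phi> x *\<^sub>R G is x))" ..
  then have G: "\<And>is. length is \<le> 3 \<Longrightarrow> borel_loc_integrable (G is)"
    and Geq: "\<And>is. length is \<le> 3 \<Longrightarrow> AE x in lborel. weak_deriv (count_list is) u x = G is x"
    and Gweak: "\<And>is \<phi>. length is \<le> 3 \<Longrightarrow> test_function \<phi> \<Longrightarrow>
      (LINT x|lborel. iter_partial is \<phi> x *\<^sub>R u' x) = (-1) ^ length is *\<^sub>R (LINT x|lborel. \<phi> x *\<^sub>R G is x)"
    by blast+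
  have "weak_partial i u = weak_deriv (count_list [i]) u" for i
    unfolding weak_partial_def by (rule arg_cong[where f = "\<lambda>\<alpha>. weak_deriv \<alpha> u"]) auto
  then have "AE x in lborel. weak_partial i u x = G [i] x" for i
    using Geq[of "[i]"] by simp
  then have P: "AE x in lborel. \<forall>i. weak_partial i u x = G [i] x"
    by (simp only: AE_all_countable simp_thms)
  define T where "T i x = (\<Sum>j\<in>UNIV. \<Sum>k\<in>UNIV. \<Sum>l\<in>UNIV. remainder i j k l (G [l, k, j]) x)" for i x
  have "AE x in lborel. average_K i u' x - G [i] x = T i x" for i
    unfolding T_def
    by (rule average_K_expansion[OF u'(1) G _ G]) (use Gweak[of "[_]"] Gweak[of "[_, _, _]"] in auto)
  then have E: "AE x in lborel. \<forall>i. average_K i u' x - G [i] x = T i x"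
    by (simp only: AE_all_countable simp_thms)
  have N: "AE x in lborel. has_bochner_integral lebesgue (\<lambda>y. indicator (horizon \<delta> x) y *\<^sub>R I x y)
      (\<Sum>i\<in>UNIV. L i (average_K i u' x))"
    using nonlocal_representative[OF u']
  proof eventually_elim
    case (elim x)
    have "has_bochner_integral lebesgue
        (\<lambda>y. \<Sum>i\<in>UNIV. L i (indicator (horizon \<delta> x) y *\<^sub>R ((\<omega> (y - x) * unit_dir x y $ i) *\<^sub>R (u y - u x))))
        (\<Sum>i\<in>UNIV. L i (average_K i u' x))"
      by (rule has_bochner_integral_sum, rule has_bochner_integral_bounded_linear[OF L], use elim in blast)
    then show ?case
      by (simp only: I scaleR_sum_right linear_scale[OF bounded_linear.linear[OF L]])
  qed
  \<comment> \<open>A Borel function equal to the consistency error almost everywhere; measurability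
    and the bound are proved for \<open>F\<close> and then transferred.\<close>
  define F where "F x = (\<Sum>i\<in>UNIV. L i (T i x))" for x
  have eq: "AE x in lborel. F x = (LINT y:horizon \<delta> x|lebesgue. I x y) - D x"
    using N P E
  proof eventually_elim
    case (elim x)
    have "(LINT y:horizon \<delta> x|lebesgue. I x y) - D x
        = (\<Sum>i\<in>UNIV. L i (average_K i u' x)) - (\<Sum>i\<in>UNIV. L i (G [i] x))"
      using has_bochner_integral_integral_eq[OF elim(1)] elim(2) by (simp add: set_lebesgue_integral_def D)
    also have "\<dots> = F x"
      unfolding F_def sum_subtractf[symmetric]
      by (intro sum.cong refl) (metis elim(3) bounded_linear.linear[OF L] linear_diff)
    finally show ?case by simp
  qed
  \<comment> \<open>There are \<open>n^4\<close> quadruples \<open>(i, j, k, l)\<close>; the squared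
    count \<open>n^8\<close> and the mass bound \<open>n * \<delta>^2\<close> of each remainder give
    \<open>n^9 * \<delta>^2\<close>.\<close>
  have "Lq_bounded q F (real (card (UNIV :: ('n \<times> 'n \<times> 'n \<times> 'n) set))^2 * (\<delta>^2 * real CARD('n) * ?S))"
  proof (rule Lq_bounded_sum[OF q])
    have [measurable]: "T i \<in> borel_measurable borel" for i
    proof -
      have "remainder i j k l (G [l, k, j]) \<in> borel_measurable borel" for j k l
        using G[of "[l, k, j]"]
        by (intro shift_average.average_measurable[OF remainder_shift_average]) (simp add: borel_loc_integrable_def)
      then show ?thesis
        unfolding T_def[abs_def] by (intro borel_measurable_sum)
    qed
    have "F \<in> borel_measurable borel"
      unfolding F_def[abs_def]
      by (intro borel_measurable_sum measurable_compose[OF _ borel_measurable_continuous_onI[OF linear_continuous_on[OF L]]])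
        measurable
    then show "F \<in> borel_measurable lebesgue"
      by (intro measurable_completion) simp
    have "norm (F x) \<le> (\<Sum>i\<in>UNIV. \<Sum>j\<in>UNIV. \<Sum>k\<in>UNIV. \<Sum>l\<in>UNIV. norm (remainder i j k l (G [l, k, j]) x))" for x
      unfolding F_def
    proof (rule order_trans[OF norm_sum sum_mono])
      fix i
      show "norm (L i (T i x)) \<le> (\<Sum>j\<in>UNIV. \<Sum>k\<in>UNIV. \<Sum>l\<in>UNIV. norm (remainder i j k l (G [l, k, j]) x))"
        unfolding T_def
        by (rule order_trans[OF L_le], rule order_trans[OF norm_sum sum_mono],
            rule order_trans[OF norm_sum sum_mono], rule norm_sum)
    qed
    moreover have "(\<Sum>m\<in>UNIV. norm ((\<lambda>(i, j, k, l). remainder i j k l (G [l, k, j])) m x))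
        = (\<Sum>i\<in>UNIV. \<Sum>j\<in>UNIV. \<Sum>k\<in>UNIV. \<Sum>l\<in>UNIV. norm (remainder i j k l (G [l, k, j]) x))" for x
      by (simp add: sum.cartesian_product case_prod_unfold UNIV_Times_UNIV[symmetric] del: UNIV_Times_UNIV)
    ultimately show "AE x in lborel. norm (F x)
        \<le> (\<Sum>m\<in>UNIV. norm ((\<lambda>(i, j, k, l). remainder i j k l (G [l, k, j])) m x))"
      by simp
    fix m :: "'n \<times> 'n \<times> 'n \<times> 'n"
    obtain i j k l where m: "m = (i, j, k, l)"
      by (cases m)
    have "Lq_bounded q (G [l, k, j]) ?S"
      using Lq_bounded_AE_cong[OF sobolev_weak_deriv(2)[OF q u] Geq, of "[l, k, j]"] by simp
    then have "Lq_bounded q (remainder i j k l (G [l, k, j])) ((LINT s|lborel. \<bar>remainder_weight i j k l s\<bar>) * ?S)"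
      using G[of "[l, k, j]"]
      by (intro average_Lq_bounded[OF remainder_shift_average q]) (auto simp: borel_loc_integrable_def)
    then show "Lq_bounded q ((\<lambda>(i, j, k, l). remainder i j k l (G [l, k, j])) m) (\<delta>^2 * real CARD('n) * ?S)"
      unfolding m prod.case
      by (rule Lq_bounded_mono[OF q]) (intro mult_right_mono remainder_weight_norm S)
  qed (use S in auto)
  also have "real (card (UNIV :: ('n \<times> 'n \<times> 'n \<times> 'n) set))^2 * (\<delta>^2 * real CARD('n) * ?S) = real CARD('n)^9 * \<delta>^2 * ?S"
    by (simp add: card_cartesian_product UNIV_Times_UNIV[symmetric] power_mult_distrib del: UNIV_Times_UNIV)
      (simp add: eval_nat_numeral)
  finally have "Lq_bounded q (\<lambda>x. (LINT y:horizon \<delta> x|lebesgue. I x y) - D x) (real CARD('n)^9 * \<delta>^2 * ?S)"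
    using eq by (rule Lq_bounded_AE_cong)
  moreover have "AE x in lebesgue. set_integrable lebesgue (horizon \<delta> x) (I x)"
    using AE_completion[OF N] by eventually_elim (auto simp: set_integrable_def has_bochner_integral_iff)
  ultimately show ?thesis
    using Lq_boundedD[OF q] by blast
qed

end

text \<open>Existence of the nonlocal integrals almost everywhere and membership in
  \<open>Lq\<close> are part of the claim: an integral that does not exist is 0 by convention, so
  the norm inequality alone could hold for the wrong reason.\<close>

theorem theorem1p1:
  fixes p :: real and q :: ereal
  assumes "0 < p" and "p < real CARD('n::finite)" and "1 \<le> q"
  shows "\<exists>C>0. \<forall>\<delta>>0.
    (\<forall>\<omega>0>0. \<forall>\<omega> :: real^'n \<Rightarrow> real. \<omega> = kernel \<omega>0 p \<delta> \<longrightarrow> normalized \<delta> \<omega> \<longrightarrow>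
      (\<forall>u :: real^'n \<Rightarrow> real^'n. u \<in> sobolev 3 q \<longrightarrow>
        (AE x in lebesgue. set_integrable lebesgue (horizon \<delta> x) (div_integrand \<omega> u x)) \<and>
        (\<lambda>x. nonlocal_div \<delta> \<omega> u x - local_div u x) \<in> Lq q \<and>
        Lq_norm q (\<lambda>x. nonlocal_div \<delta> \<omega> u x - local_div u x) \<le> C * \<delta>^2 * sobolev_norm 3 q u) \<and>
      (\<forall>u :: real^'n \<Rightarrow> real. u \<in> sobolev 3 q \<longrightarrow>
        (AE x in lebesgue. set_integrable lebesgue (horizon \<delta> x) (grad_integrand \<omega> u x)) \<and>
        (\<lambda>x. nonlocal_grad \<delta> \<omega> u x - local_grad u x) \<in> Lq q \<and>
        Lq_norm q (\<lambda>x. nonlocal_grad \<delta> \<omega> u x - local_grad u x) \<le> C * \<delta>^2 * sobolev_norm 3 q u)) \<and>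
    (CARD('n) = 3 \<longrightarrow>
      (\<forall>\<omega>0>0. \<forall>\<omega> :: real^3 \<Rightarrow> real. \<omega> = kernel \<omega>0 p \<delta> \<longrightarrow> normalized \<delta> \<omega> \<longrightarrow>
        (\<forall>u :: real^3 \<Rightarrow> real^3. u \<in> sobolev 3 q \<longrightarrow>
          (AE x in lebesgue. set_integrable lebesgue (horizon \<delta> x) (curl_integrand \<omega> u x)) \<and>
          (\<lambda>x. nonlocal_curl \<delta> \<omega> u x - local_curl u x) \<in> Lq q \<and>
          Lq_norm q (\<lambda>x. nonlocal_curl \<delta> \<omega> u x - local_curl u x) \<le> C * \<delta>^2 * sobolev_norm 3 q u)))"
proof (intro exI[of _ "real CARD('n)^9"] conjI allI impI)
  show "0 < real CARD('n)^9"
    by simp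
next
  fix \<delta> \<omega>0 :: real and \<omega> :: "real^'n \<Rightarrow> real" and u :: "real^'n \<Rightarrow> real^'n"
  assume *: "0 < \<delta>" "0 < \<omega>0" "\<omega> = kernel \<omega>0 p \<delta>" "normalized \<delta> \<omega>" and u: "u \<in> sobolev 3 q"
  interpret normalized_kernel \<omega>0 p \<delta> \<omega>
    using * assms by unfold_locales auto
  have "(AE x in lebesgue. set_integrable lebesgue (horizon \<delta> x) (div_integrand \<omega> u x)) \<and>
    (\<lambda>x. (LINT y:horizon \<delta> x|lebesgue. div_integrand \<omega> u x y) - local_div u x) \<in> Lq q \<and>
    Lq_norm q (\<lambda>x. (LINT y:horizon \<delta> x|lebesgue. div_integrand \<omega> u x y) - local_div u x)
      \<le> real CARD('n)^9 * \<delta>^2 * sobolev_norm 3 q u"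
  proof (rule nonlocal_estimate[OF \<open>1 \<le> q\<close> u])
    show "bounded_linear (\<lambda>w::real^'n. w $ i)" for i
      by (rule bounded_linear_vec_nth)
    show "norm (w $ i) \<le> norm w" for w :: "real^'n" and i
      by (rule Finite_Cartesian_Product.norm_nth_le)
    show "div_integrand \<omega> u x y = (\<Sum>i\<in>UNIV. (\<omega> (y - x) * unit_dir x y $ i) *\<^sub>R ((u y - u x) $ i))" for x y
      by (simp add: div_integrand_def inner_vec_def sum_distrib_left mult_ac)
  qed (simp add: local_div_def)
  then show "AE x in lebesgue. set_integrable lebesgue (horizon \<delta> x) (div_integrand \<omega> u x)"
    "(\<lambda>x. nonlocal_div \<delta> \<omega> u x - local_div u x) \<in> Lq q"
    "Lq_norm q (\<lambda>x. nonlocal_div \<delta> \<omega> u x - local_div u x) \<le> real CARD('n)^9 * \<delta>^2 * sobolev_norm 3 q u"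
    by (simp_all add: nonlocal_div_def)
next
  fix \<delta> \<omega>0 :: real and \<omega> :: "real^'n \<Rightarrow> real" and u :: "real^'n \<Rightarrow> real"
  assume *: "0 < \<delta>" "0 < \<omega>0" "\<omega> = kernel \<omega>0 p \<delta>" "normalized \<delta> \<omega>" and u: "u \<in> sobolev 3 q"
  interpret normalized_kernel \<omega>0 p \<delta> \<omega>
    using * assms by unfold_locales auto
  have "(AE x in lebesgue. set_integrable lebesgue (horizon \<delta> x) (grad_integrand \<omega> u x)) \<and>
    (\<lambda>x. (LINT y:horizon \<delta> x|lebesgue. grad_integrand \<omega> u x y) - local_grad u x) \<in> Lq q \<and>
    Lq_norm q (\<lambda>x. (LINT y:horizon \<delta> x|lebesgue. grad_integrand \<omega> u x y) - local_grad u x)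
      \<le> real CARD('n)^9 * \<delta>^2 * sobolev_norm 3 q u"
  proof (rule nonlocal_estimate[OF \<open>1 \<le> q\<close> u])
    show "bounded_linear (\<lambda>w::real. w *\<^sub>R (axis i 1 :: real^'n))" for i
      by (rule bounded_linear_scaleR_left)
    show "norm (w *\<^sub>R (axis i 1 :: real^'n)) \<le> norm w" for w :: real and i
      by simp
    show "grad_integrand \<omega> u x y = (\<Sum>i\<in>UNIV. (\<omega> (y - x) * unit_dir x y $ i) *\<^sub>R ((u y - u x) *\<^sub>R axis i 1))" for x y
      by (simp add: grad_integrand_def vec_eq_iff axis_def if_distrib[of "\<lambda>c. _ * c"] cong: if_cong)
    show "local_grad u x = (\<Sum>i\<in>UNIV. weak_partial i u x *\<^sub>R axis i 1)" for x
      by (simp add: local_grad_def vec_eq_iff axis_def if_distrib[of "\<lambda>c. _ * c"] cong: if_cong)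
  qed
  then show "AE x in lebesgue. set_integrable lebesgue (horizon \<delta> x) (grad_integrand \<omega> u x)"
    "(\<lambda>x. nonlocal_grad \<delta> \<omega> u x - local_grad u x) \<in> Lq q"
    "Lq_norm q (\<lambda>x. nonlocal_grad \<delta> \<omega> u x - local_grad u x) \<le> real CARD('n)^9 * \<delta>^2 * sobolev_norm 3 q u"
    by (simp_all add: nonlocal_grad_def)
next
  fix \<delta> \<omega>0 :: real and \<omega> :: "real^3 \<Rightarrow> real" and u :: "real^3 \<Rightarrow> real^3"
  assume 3: "CARD('n) = 3"
    and *: "0 < \<delta>" "0 < \<omega>0" "\<omega> = kernel \<omega>0 p \<delta>" "normalized \<delta> \<omega>" and u: "u \<in> sobolev 3 q"
  \<comment> \<open>The curl lives over the index type \<open>3\<close>. The equation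
    \<open>CARD('n) = 3\<close> carries the condition on \<open>p\<close> over to it and, at the
    end, the constant back.\<close>
  interpret normalized_kernel \<omega>0 p \<delta> \<omega>
    using * assms 3 by unfold_locales auto
  have "(AE x in lebesgue. set_integrable lebesgue (horizon \<delta> x) (curl_integrand \<omega> u x)) \<and>
    (\<lambda>x. (LINT y:horizon \<delta> x|lebesgue. curl_integrand \<omega> u x y) - local_curl u x) \<in> Lq q \<and>
    Lq_norm q (\<lambda>x. (LINT y:horizon \<delta> x|lebesgue. curl_integrand \<omega> u x y) - local_curl u x)
      \<le> real CARD(3)^9 * \<delta>^2 * sobolev_norm 3 q u"
  proof (rule nonlocal_estimate[OF \<open>1 \<le> q\<close> u])
    show "bounded_linear (cross3 (axis i 1))" for i
      using bilinear_cross by (simp add: bilinear_def linear_conv_bounded_linear)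
    show "norm (cross3 (axis i 1) w) \<le> norm w" for i w
    proof (rule power2_le_imp_le)
      \<comment> \<open>Lagrange's identity: the square of the cross product with a unit vector is
        the square of \<open>norm w\<close> minus a squared inner product.\<close>
      show "(norm (cross3 (axis i 1) w))\<^sup>2 \<le> (norm w)\<^sup>2"
        by (simp add: norm_cross)
    qed simp
    show "curl_integrand \<omega> u x y = (\<Sum>i\<in>UNIV. (\<omega> (y - x) * unit_dir x y $ i) *\<^sub>R cross3 (axis i 1) (u y - u x))" for x y
      by (simp add: curl_integrand_def sum_3 cross3_def vec_eq_iff forall_3 axis_def algebra_simps)
    show "local_curl u x = (\<Sum>i\<in>UNIV. cross3 (axis i 1) (weak_partial i u x))" for x
      by (simp add: local_curl_def sum_3 cross3_def vec_eq_iff forall_3 axis_def)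
  qed
  then show "AE x in lebesgue. set_integrable lebesgue (horizon \<delta> x) (curl_integrand \<omega> u x)"
    "(\<lambda>x. nonlocal_curl \<delta> \<omega> u x - local_curl u x) \<in> Lq q"
    "Lq_norm q (\<lambda>x. nonlocal_curl \<delta> \<omega> u x - local_curl u x) \<le> real CARD('n)^9 * \<delta>^2 * sobolev_norm 3 q u"
    by (simp_all add: nonlocal_curl_def 3)
qed

end
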